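(* Let $\mathfrak g$ be a locally convex Lie algebra and let $\mathfrak h$ be an internal Lie subalgebra of $\mathfrak g^*$. Then the Lie bracket $[\cdot,\cdot]:\hat{\mathfrak h}\times\hat{\mathfrak h}\to\hat{\mathfrak h}$ is continuous, and thus $\hat{\mathfrak h}$ is a locally convex Lie algebra.
   Context: We work in a sufficiently saturated nonstandard extension; $A^*$ is the nonstandard extension of $A$. A locally convex Lie algebra is a locally convex space (real Hausdorff topological vector space with a base of convex neighborhoods of $0$) with a continuous Lie bracket. $\Gamma_{\mathfrak g}$ is the set of all continuous seminorms on $\mathfrak g$. An internal Lie subalgebra $\mathfrak h$ of $\mathfrak g^*$ is an internal linear subspace of $\mathfrak g^*$ with $[\mathfrak h,\mathfrak h]\subseteq\mathfrak h$. Put $\mathfrak h_f=\{x\in\mathfrak h : p(x)$ is a finite hyperreal for all $p\in\Gamma_{\mathfrak g}\}$ and $\mu_{\mathfrak h}=\{x\in\mathfrak h : p(x)$ is infinitesimal for all $p\in\Gamma_{\mathfrak g}\}$. Then $\mathfrak h_f$ is a real Lie algebra with Lie ideal $\mu_{\mathfrak h}$, and the nonstandard hull of $\mathfrak h$ is the real Lie algebra $\hat{\mathfrak h}=\mathfrak h_f/\mu_{\mathfrak h}$ with bracket $[x+\mu_{\mathfrak h},y+\mu_{\mathfrak h}]=[x,y]+\mu_{\mathfrak h}$. It is equipped with the (Hausdorff) locally convex topology given by the separating family of seminorms $\hat p(x+\mu_{\mathfrak h})=\operatorname{st}(p(x))$, $p\in\Gamma_{\mathfrak g}$. *)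

theory Defs
  imports "HOL-Analysis.Analysis" "HOL-Algebra.Module"
begin

section \<open>Locally convex Lie algebras\<close>

text \<open>
  Vector spaces are modules in the sense of HOL-Algebra, over the real field regarded as a ring.
  The fields \<open>mult\<close> and \<open>one\<close>, which the record type of modules inherits from rings,
  carry no meaning here; the Lie bracket has its own field.
\<close>

definition real_ring :: "real ring" where
  "real_ring = \<lparr>carrier = UNIV, mult = (*), one = 1, zero = 0, add = (+)\<rparr>"

record 'a lie = "(real, 'a) module" +
  bracket :: "'a \<Rightarrow> 'a \<Rightarrow> 'a"

locale lie_algebra = Module.module real_ring L for L :: "'a lie" (structure) +
  assumes bracket_closed:
      "\<lbrakk>x \<in> carrier L; y \<in> carrier L\<rbrakk> \<Longrightarrow> bracket L x y \<in> carrier L"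
    and bracket_add_left:
      "\<lbrakk>x \<in> carrier L; y \<in> carrier L; z \<in> carrier L\<rbrakk>
        \<Longrightarrow> bracket L (x \<oplus> y) z = bracket L x z \<oplus> bracket L y z"
    and bracket_add_right:
      "\<lbrakk>x \<in> carrier L; y \<in> carrier L; z \<in> carrier L\<rbrakk>
        \<Longrightarrow> bracket L x (y \<oplus> z) = bracket L x y \<oplus> bracket L x z"
    and bracket_smult_left:
      "\<lbrakk>x \<in> carrier L; y \<in> carrier L\<rbrakk> \<Longrightarrow> bracket L (c \<odot> x) y = c \<odot> bracket L x y"
    and bracket_smult_right:
      "\<lbrakk>x \<in> carrier L; y \<in> carrier L\<rbrakk> \<Longrightarrow> bracket L x (c \<odot> y) = c \<odot> bracket L x y"
    and bracket_self: "x \<in> carrier L \<Longrightarrow> bracket L x x = \<zero>"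
    and jacobi:
      "\<lbrakk>x \<in> carrier L; y \<in> carrier L; z \<in> carrier L\<rbrakk>
        \<Longrightarrow> bracket L x (bracket L y z) \<oplus> bracket L y (bracket L z x)
              \<oplus> bracket L z (bracket L x y) = \<zero>"

definition convex_in :: "'a lie \<Rightarrow> 'a set \<Rightarrow> bool" where
  "convex_in L C \<longleftrightarrow> C \<subseteq> carrier L \<and>
     (\<forall>x\<in>C. \<forall>y\<in>C. \<forall>u\<ge>0. \<forall>v\<ge>0. u + v = 1 \<longrightarrow> u \<odot>\<^bsub>L\<^esub> x \<oplus>\<^bsub>L\<^esub> v \<odot>\<^bsub>L\<^esub> y \<in> C)"

definition locally_convex_space :: "'a lie \<Rightarrow> 'a topology \<Rightarrow> bool" where
  "locally_convex_space L T \<longleftrightarrow>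
     Module.module real_ring L \<and>
     topspace T = carrier L \<and>
     Hausdorff_space T \<and>
     continuous_map (prod_topology T T) T (\<lambda>(x, y). x \<oplus>\<^bsub>L\<^esub> y) \<and>
     continuous_map (prod_topology euclideanreal T) T (\<lambda>(c, x). c \<odot>\<^bsub>L\<^esub> x) \<and>
     neighbourhood_base_at \<zero>\<^bsub>L\<^esub> (convex_in L) T"

definition locally_convex_lie_algebra :: "'a lie \<Rightarrow> 'a topology \<Rightarrow> bool" where
  "locally_convex_lie_algebra L T \<longleftrightarrow>
     locally_convex_space L T \<and> lie_algebra L \<and>
     continuous_map (prod_topology T T) T (\<lambda>(x, y). bracket L x y)"

definition seminorm_on :: "'a lie \<Rightarrow> ('a \<Rightarrow> real) \<Rightarrow> bool" where
  "seminorm_on L p \<longleftrightarrow>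
     (\<forall>x\<in>carrier L. 0 \<le> p x) \<and>
     (\<forall>c. \<forall>x\<in>carrier L. p (c \<odot>\<^bsub>L\<^esub> x) = \<bar>c\<bar> * p x) \<and>
     (\<forall>x\<in>carrier L. \<forall>y\<in>carrier L. p (x \<oplus>\<^bsub>L\<^esub> y) \<le> p x + p y)"

text \<open>
  The set \<open>\<Gamma>\<close> of all continuous seminorms.  Extensionality removes the arbitrary values outside
  the carrier, so that the cardinality of this set is the intended one.
\<close>

definition cont_seminorms :: "'a lie \<Rightarrow> 'a topology \<Rightarrow> ('a \<Rightarrow> real) set" where
  "cont_seminorms L T =
     {p \<in> extensional (carrier L). seminorm_on L p \<and> continuous_map T euclideanreal p}"

text \<open>
  The locally convex topology given by a nonempty family \<open>P\<close> of seminorms: the open semiballs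
  form a subbase.
\<close>

definition seminorm_topology :: "'a lie \<Rightarrow> ('a \<Rightarrow> real) set \<Rightarrow> 'a topology" where
  "seminorm_topology L P = topology_generated_by
     {{y \<in> carrier L. p (y \<ominus>\<^bsub>L\<^esub> x) < e} | p x e. p \<in> P \<and> x \<in> carrier L \<and> 0 < (e::real)}"


section \<open>Nonstandard extensions\<close>

text \<open>
  A nonstandard extension of a standard universe \<open>'u\<close> consists of a type \<open>'s\<close> (the extension of
  \<open>'u\<close>), an embedding of \<open>'u\<close> into \<open>'s\<close>, and for every relation \<open>R\<close> on \<open>'u\<close> (a set of tuples,
  coded as lists) its extension \<open>star R\<close>, a relation on \<open>'s\<close>, such that the transfer principle
  holds for all first-order formulas in the language that has a symbol for every relation
  on \<open>'u\<close>, with parameters from \<open>'u\<close>.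
\<close>

record ('u, 's) extension =
  emb :: "'u \<Rightarrow> 's"
  star :: "'u list set \<Rightarrow> 's list set"

datatype 'u fm =
    Rel "'u list set" "nat list"
  | Eq nat nat
  | Neg "'u fm"
  | Conj "'u fm" "'u fm"
  | Exi nat "'u fm"

primrec sat :: "('u list set \<Rightarrow> 's list set) \<Rightarrow> (nat \<Rightarrow> 's) \<Rightarrow> 'u fm \<Rightarrow> bool" where
  "sat I v (Rel R ns) \<longleftrightarrow> map v ns \<in> I R"
| "sat I v (Eq m n) \<longleftrightarrow> v m = v n"
| "sat I v (Neg f) \<longleftrightarrow> \<not> sat I v f"
| "sat I v (Conj f g) \<longleftrightarrow> sat I v f \<and> sat I v g"
| "sat I v (Exi n f) \<longleftrightarrow> (\<exists>x. sat I (v(n := x)) f)"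

definition transfer_principle :: "('u, 's) extension \<Rightarrow> bool" where
  "transfer_principle E \<longleftrightarrow>
     (\<forall>f v. sat (\<lambda>R. R) v f \<longleftrightarrow> sat (star E) (emb E \<circ> v) f)"

text \<open>
  The standard universe: the first stage \<open>X \<union> Pow X\<close> of the superstructure over the set \<open>X\<close> of
  atoms.  A larger universe would be of no use here, since the only sets whose internality
  matters below are subsets of \<open>*X\<close>, and functions and relations on \<open>X\<close> are extended
  through their graphs.
\<close>

datatype 'x univ = Atom 'x | Coll "'x set"

definition star_set :: "('u, 's) extension \<Rightarrow> 'u set \<Rightarrow> 's set" where
  "star_set E A = {x. [x] \<in> star E ((\<lambda>a. [a]) ` A)}"

text \<open>The value at \<open>xs\<close> of the extension of the function whose graph is \<open>R\<close>.\<close>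

definition star_app :: "('u, 's) extension \<Rightarrow> 'u list set \<Rightarrow> 's list \<Rightarrow> 's" where
  "star_app E R xs = (THE y. xs @ [y] \<in> star E R)"

text \<open>The internal subsets of \<open>*X\<close> are the extents of the elements of \<open>*(Pow X)\<close>.\<close>

definition internal :: "('x univ, 's) extension \<Rightarrow> 's set \<Rightarrow> bool" where
  "internal E H \<longleftrightarrow>
     (\<exists>a \<in> star_set E (range Coll).
        H = {x. [x, a] \<in> star E {[Atom t, Coll A] | t A. t \<in> A}})"

text \<open>Saturation for families of internal sets of cardinality at most that of \<open>K\<close>.\<close>

definition saturated :: "('x univ, 's) extension \<Rightarrow> 'k set \<Rightarrow> bool" where
  "saturated E K \<longleftrightarrow>
     (\<forall>F. F \<lesssim> K \<and> (\<forall>A\<in>F. internal E A) \<and>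
          (\<forall>F'. F' \<subseteq> F \<and> finite F' \<longrightarrow> \<Inter>F' \<noteq> {})
        \<longrightarrow> \<Inter>F \<noteq> {})"

text \<open>The atoms are the vectors and the real numbers.\<close>

type_synonym ('g, 's) lie_extension = "(('g + real) univ, 's) extension"

abbreviation vec :: "'g \<Rightarrow> ('g + real) univ" where
  "vec x \<equiv> Atom (Inl x)"

abbreviation num :: "real \<Rightarrow> ('g + real) univ" where
  "num r \<equiv> Atom (Inr r)"


subsection \<open>Hyperreals\<close>

definition hless :: "('g, 's) lie_extension \<Rightarrow> 's \<Rightarrow> 's \<Rightarrow> bool" where
  "hless E x y \<longleftrightarrow> [x, y] \<in> star E {[num r, num s] | r s. r < s}"

definition habs :: "('g, 's) lie_extension \<Rightarrow> 's \<Rightarrow> 's" where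
  "habs E x = star_app E {[num r, num \<bar>r\<bar>] | r. True} [x]"

definition hminus :: "('g, 's) lie_extension \<Rightarrow> 's \<Rightarrow> 's \<Rightarrow> 's" where
  "hminus E x y = star_app E {[num r, num s, num (r - s)] | r s. True} [x, y]"

definition hfinite :: "('g, 's) lie_extension \<Rightarrow> 's \<Rightarrow> bool" where
  "hfinite E x \<longleftrightarrow> x \<in> star_set E (range num) \<and> (\<exists>r. hless E (habs E x) (emb E (num r)))"

definition hinfinitesimal :: "('g, 's) lie_extension \<Rightarrow> 's \<Rightarrow> bool" where
  "hinfinitesimal E x \<longleftrightarrow>
     x \<in> star_set E (range num) \<and> (\<forall>r>0. hless E (habs E x) (emb E (num r)))"

definition st :: "('g, 's) lie_extension \<Rightarrow> 's \<Rightarrow> real" where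
  "st E x = (THE r. hinfinitesimal E (hminus E x (emb E (num r))))"


subsection \<open>The nonstandard extension of a Lie algebra and its internal subalgebras\<close>

definition star_add :: "('g, 's) lie_extension \<Rightarrow> 'g lie \<Rightarrow> 's \<Rightarrow> 's \<Rightarrow> 's" where
  "star_add E L x y = star_app E
     {[vec a, vec b, vec (a \<oplus>\<^bsub>L\<^esub> b)] | a b. a \<in> carrier L \<and> b \<in> carrier L} [x, y]"

definition star_smult :: "('g, 's) lie_extension \<Rightarrow> 'g lie \<Rightarrow> 's \<Rightarrow> 's \<Rightarrow> 's" where
  "star_smult E L c x = star_app E
     {[num r, vec a, vec (r \<odot>\<^bsub>L\<^esub> a)] | r a. a \<in> carrier L} [c, x]"

definition star_bracket :: "('g, 's) lie_extension \<Rightarrow> 'g lie \<Rightarrow> 's \<Rightarrow> 's \<Rightarrow> 's" where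
  "star_bracket E L x y = star_app E
     {[vec a, vec b, vec (bracket L a b)] | a b. a \<in> carrier L \<and> b \<in> carrier L} [x, y]"

definition star_seminorm ::
    "('g, 's) lie_extension \<Rightarrow> 'g lie \<Rightarrow> ('g \<Rightarrow> real) \<Rightarrow> 's \<Rightarrow> 's" where
  "star_seminorm E L p x = star_app E {[vec a, num (p a)] | a. a \<in> carrier L} [x]"

text \<open>As for all internal linear subspaces, the scalars are the hyperreals.\<close>

definition internal_lie_subalgebra :: "('g, 's) lie_extension \<Rightarrow> 'g lie \<Rightarrow> 's set \<Rightarrow> bool" where
  "internal_lie_subalgebra E L H \<longleftrightarrow>
     internal E H \<and>
     H \<subseteq> star_set E (vec ` carrier L) \<and>
     emb E (vec \<zero>\<^bsub>L\<^esub>) \<in> H \<and>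
     (\<forall>x\<in>H. \<forall>y\<in>H. star_add E L x y \<in> H) \<and>
     (\<forall>c \<in> star_set E (range num). \<forall>x\<in>H. star_smult E L c x \<in> H) \<and>
     (\<forall>x\<in>H. \<forall>y\<in>H. star_bracket E L x y \<in> H)"


section \<open>The nonstandard hull\<close>

definition fin_part ::
    "('g, 's) lie_extension \<Rightarrow> 'g lie \<Rightarrow> 'g topology \<Rightarrow> 's set \<Rightarrow> 's set" where
  "fin_part E L T H = {x \<in> H. \<forall>p \<in> cont_seminorms L T. hfinite E (star_seminorm E L p x)}"

definition inf_part ::
    "('g, 's) lie_extension \<Rightarrow> 'g lie \<Rightarrow> 'g topology \<Rightarrow> 's set \<Rightarrow> 's set" where
  "inf_part E L T H =
     {x \<in> H. \<forall>p \<in> cont_seminorms L T. hinfinitesimal E (star_seminorm E L p x)}"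

definition hull_class ::
    "('g, 's) lie_extension \<Rightarrow> 'g lie \<Rightarrow> 'g topology \<Rightarrow> 's set \<Rightarrow> 's \<Rightarrow> 's set" where
  "hull_class E L T H x = star_add E L x ` inf_part E L T H"

text \<open>
  The operations on cosets are unions over all representatives, as for quotient rings in
  HOL-Algebra; such a union is a single coset precisely if the operation is well defined.
  A real scalar \<open>c\<close> acts on \<open>*g\<close> as the standard hyperreal \<open>emb E (num c)\<close>.
\<close>

definition nonstd_hull ::
    "('g, 's) lie_extension \<Rightarrow> 'g lie \<Rightarrow> 'g topology \<Rightarrow> 's set \<Rightarrow> 's set lie" where
  "nonstd_hull E L T H =
     \<lparr>carrier = hull_class E L T H ` fin_part E L T H,
      mult = undefined, one = undefined,
      zero = inf_part E L T H,
      add = (\<lambda>X Y. \<Union>x\<in>X. \<Union>y\<in>Y. hull_class E L T H (star_add E L x y)),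
      smult = (\<lambda>c X. \<Union>x\<in>X. hull_class E L T H (star_smult E L (emb E (num c)) x)),
      bracket = (\<lambda>X Y. \<Union>x\<in>X. \<Union>y\<in>Y. hull_class E L T H (star_bracket E L x y))\<rparr>"

text \<open>
  The common value of \<open>st (p x)\<close> for all representatives \<open>x\<close>.
\<close>

definition hull_seminorm ::
    "('g, 's) lie_extension \<Rightarrow> 'g lie \<Rightarrow> ('g \<Rightarrow> real) \<Rightarrow> 's set \<Rightarrow> real" where
  "hull_seminorm E L p X = the_elem ((\<lambda>x. st E (star_seminorm E L p x)) ` X)"

definition hull_topology ::
    "('g, 's) lie_extension \<Rightarrow> 'g lie \<Rightarrow> 'g topology \<Rightarrow> 's set \<Rightarrow> 's set topology" where
  "hull_topology E L T H =
     seminorm_topology (nonstd_hull E L T H) (hull_seminorm E L ` cont_seminorms L T)"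

end

theory Submission
  imports Defs
begin

text \<open>
  The bracket of a locally convex Lie algebra \<open>L\<close> is controlled by its continuous seminorms: for every
  continuous seminorm \<open>p\<close> there is another one, \<open>q\<close>, with \<open>p [x, y] \<le> q x * q y\<close>
  (\<open>bracket_bounded_cont_seminorms\<close>).  For \<open>q\<close> one takes the Minkowski functional of a symmetric convex
  neighbourhood of zero on which the bracket has \<open>p\<close>-values below 1, and rescales.

  This inequality does all the work.  By transfer it holds for nonstandard elements; hence brackets
  of finite elements are finite, and on taking standard parts the seminorms \<open>st (p x)\<close> on the real Lie
  algebra of finite elements satisfy the same inequality (\<open>seminormed_lie_algebra_finite\<close>).
  The infinitesimal elements are the common null space of these seminorms.  The inequality makes
  this null space a Lie ideal, and the hull is the quotient by it, with a separating family of
  seminorms that satisfies the same inequality again (\<open>seminormed_lie_algebra_quotient\<close>).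
  Finally, in any Lie algebra with a separating family of seminorms of this kind, the bracket
  is continuous, since the values of \<open>p\<close> on \<open>[x, y] - [a, b]\<close> are bounded by an expression in
  \<open>q (x - a)\<close> and \<open>q (y - b)\<close> that vanishes at \<open>(a, b)\<close>
  (\<open>locally_convex_lie_algebra_seminorm_topology\<close>).

  Transfer is used through germs.  A tuple \<open>xs\<close> of nonstandard elements determines an ultrafilter
  \<open>germ E xs\<close> on standard tuples, and elements definable from \<open>xs\<close> are represented by functions of standard
  tuples.  A relation holds between such elements if and only if it holds eventually between the
  representing functions (\<open>star_rep_iff\<close>), and the standard part of a finite hyperreal is the limit of
  a function that represents it (\<open>hfinite_tendsto_st\<close>).  So algebraic laws and inequalities become
  pointwise statements, and statements about standard parts become statements about limits.
\<close>


section \<open>Real vector spaces and seminorms\<close>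

lemma real_ring_simps [simp]:
  "carrier real_ring = UNIV" "mult real_ring = (*)" "one real_ring = 1"
  "zero real_ring = 0" "add real_ring = (+)"
  by (simp_all add: real_ring_def)

lemma cring_real_ring: "cring real_ring"
proof (rule cringI)
  show "abelian_group real_ring"
    by (rule abelian_groupI) (auto intro: exI[of _ "- x" for x])
  show "Group.comm_monoid real_ring"
    by (rule comm_monoidI) auto
qed (auto simp: algebra_simps)

locale real_module = Module.module real_ring L for L :: "'a lie" (structure)
begin

lemma scale_closed [simp, intro]: "x \<in> carrier L \<Longrightarrow> c \<odot> x \<in> carrier L"
  using smult_closed by simp

lemma scale_add_left: "x \<in> carrier L \<Longrightarrow> (c + d) \<odot> x = c \<odot> x \<oplus> d \<odot> x"
  using smult_l_distr by simp

lemma scale_add_right: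
  "x \<in> carrier L \<Longrightarrow> y \<in> carrier L \<Longrightarrow> c \<odot> (x \<oplus> y) = c \<odot> x \<oplus> c \<odot> y"
  using smult_r_distr by simp

lemma scale_scale: "x \<in> carrier L \<Longrightarrow> c \<odot> (d \<odot> x) = (c * d) \<odot> x"
  using smult_assoc1 by simp

lemma scale_one [simp]: "x \<in> carrier L \<Longrightarrow> 1 \<odot> x = x"
  using smult_one by simp

lemma scale_zero [simp]: "x \<in> carrier L \<Longrightarrow> 0 \<odot> x = \<zero>"
  using smult_l_null by simp

lemma scale_zero_right [simp]: "c \<odot> \<zero> = \<zero>"
  using smult_r_null by simp

lemma scale_minus_one: "x \<in> carrier L \<Longrightarrow> (- 1) \<odot> x = \<ominus> x"
  using scale_add_left[of x "- 1" 1] by (intro M.minus_equality[symmetric]) auto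

lemma add_minus_cancel: "x \<in> carrier L \<Longrightarrow> y \<in> carrier L \<Longrightarrow> (x \<ominus> y) \<oplus> y = x"
  by (simp add: a_minus_def M.a_assoc M.l_neg)

lemma minus_self [simp]: "x \<in> carrier L \<Longrightarrow> x \<ominus> x = \<zero>"
  by (simp add: a_minus_def M.r_neg)

end

sublocale lie_algebra \<subseteq> real_module ..

lemma seminorm_onD:
  assumes "seminorm_on L p"
  shows seminorm_nonneg: "x \<in> carrier L \<Longrightarrow> 0 \<le> p x"
    and seminorm_scale: "x \<in> carrier L \<Longrightarrow> p (c \<odot>\<^bsub>L\<^esub> x) = \<bar>c\<bar> * p x"
    and seminorm_triangle: "x \<in> carrier L \<Longrightarrow> y \<in> carrier L \<Longrightarrow> p (x \<oplus>\<^bsub>L\<^esub> y) \<le> p x + p y"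
  using assms by (auto simp: seminorm_on_def)

context real_module
begin

lemma seminorm_zero: "seminorm_on L p \<Longrightarrow> p \<zero> = 0"
  using seminorm_scale[of L p \<zero> 0] by simp

lemma seminorm_uminus: "seminorm_on L p \<Longrightarrow> x \<in> carrier L \<Longrightarrow> p (\<ominus> x) = p x"
  using seminorm_scale[of L p x "- 1"] by (simp add: scale_minus_one)

lemma seminorm_minus_commute:
  assumes "seminorm_on L p" "x \<in> carrier L" "y \<in> carrier L"
  shows "p (x \<ominus> y) = p (y \<ominus> x)"
proof -
  have "\<ominus> (x \<ominus> y) = y \<ominus> x"
    using assms by (simp add: a_minus_def M.minus_add M.a_comm)
  then show ?thesis
    using seminorm_uminus[OF assms(1), of "x \<ominus> y"] assms by simp
qed

lemma seminorm_minus_triangle: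
  assumes "seminorm_on L p" "x \<in> carrier L" "y \<in> carrier L" "z \<in> carrier L"
  shows "p (x \<ominus> z) \<le> p (x \<ominus> y) + p (y \<ominus> z)"
proof -
  have "x \<ominus> z = (x \<ominus> y) \<oplus> (y \<ominus> z)"
    using add_minus_cancel[of x y] assms M.a_assoc[of "x \<ominus> y" y "\<ominus> z"]
    by (simp add: a_minus_def)
  then show ?thesis using seminorm_triangle[OF assms(1)] assms by simp
qed

lemma seminorm_diff_le:
  assumes "seminorm_on L p" "x \<in> carrier L" "y \<in> carrier L"
  shows "\<bar>p x - p y\<bar> \<le> p (x \<ominus> y)"
  using seminorm_triangle[OF assms(1), of "x \<ominus> y" y] seminorm_triangle[OF assms(1), of "y \<ominus> x" x]
    seminorm_minus_commute[OF assms] assms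
  by (simp add: add_minus_cancel)

end

text \<open>
  Continuity of the bracket in a quantitative form.  Unlike continuity itself, such an inequality
  survives the passage to standard parts.
\<close>

definition bracket_bounded :: "'a lie \<Rightarrow> ('a \<Rightarrow> real) set \<Rightarrow> bool" where
  "bracket_bounded L P \<longleftrightarrow>
     (\<forall>p\<in>P. \<exists>q\<in>P. \<forall>x\<in>carrier L. \<forall>y\<in>carrier L. p (bracket L x y) \<le> q x * q y)"

lemma bracket_boundedE:
  assumes "bracket_bounded L P" "p \<in> P"
  obtains q where "q \<in> P"
    "\<And>x y. x \<in> carrier L \<Longrightarrow> y \<in> carrier L \<Longrightarrow> p (bracket L x y) \<le> q x * q y"
  using assms unfolding bracket_bounded_def by blast


section \<open>Quotients of Lie algebras\<close>

locale lie_ideal = lie_algebra L for L :: "'a lie" (structure) +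
  fixes I :: "'a set"
  assumes ideal_subset: "I \<subseteq> carrier L"
    and ideal_zero: "\<zero> \<in> I"
    and ideal_add: "m \<in> I \<Longrightarrow> n \<in> I \<Longrightarrow> m \<oplus> n \<in> I"
    and ideal_scale: "n \<in> I \<Longrightarrow> c \<odot> n \<in> I"
    and ideal_bracket_left: "x \<in> carrier L \<Longrightarrow> n \<in> I \<Longrightarrow> bracket L x n \<in> I"
    and ideal_bracket_right: "x \<in> carrier L \<Longrightarrow> n \<in> I \<Longrightarrow> bracket L n x \<in> I"

definition lie_coset :: "'a lie \<Rightarrow> 'a set \<Rightarrow> 'a \<Rightarrow> 'a set" where
  "lie_coset L I x = add L x ` I"

text \<open>
  The operations are unions over all representatives, in the same form as for nonstandard hulls, so
  that a hull is literally an instance.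
\<close>

definition lie_quotient :: "'a lie \<Rightarrow> 'a set \<Rightarrow> 'a set lie" where
  "lie_quotient L I =
     \<lparr>carrier = lie_coset L I ` carrier L,
      mult = undefined, one = undefined,
      zero = I,
      add = (\<lambda>X Y. \<Union>x\<in>X. \<Union>y\<in>Y. lie_coset L I (x \<oplus>\<^bsub>L\<^esub> y)),
      smult = (\<lambda>c X. \<Union>x\<in>X. lie_coset L I (c \<odot>\<^bsub>L\<^esub> x)),
      bracket = (\<lambda>X Y. \<Union>x\<in>X. \<Union>y\<in>Y. lie_coset L I (bracket L x y))\<rparr>"

context lie_ideal
begin

abbreviation coset where "coset \<equiv> lie_coset L I"
abbreviation Q where "Q \<equiv> lie_quotient L I"

lemma ideal_carrier [simp]: "n \<in> I \<Longrightarrow> n \<in> carrier L"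
  using ideal_subset by blast

lemma ideal_uminus: "n \<in> I \<Longrightarrow> \<ominus> n \<in> I"
  using ideal_scale[of n "- 1"] by (simp add: scale_minus_one)

lemma coset_absorb:
  assumes "x \<in> carrier L" "n \<in> I"
  shows "coset (x \<oplus> n) = coset x"
proof -
  have "x \<oplus> n \<oplus> m \<in> coset x" if "m \<in> I" for m
    using that assms by (auto simp: lie_coset_def M.a_assoc intro: ideal_add)
  moreover have "x \<oplus> m \<in> coset (x \<oplus> n)" if "m \<in> I" for m
  proof -
    have "x \<oplus> m = x \<oplus> n \<oplus> (\<ominus> n \<oplus> m)"
      using that assms by (simp add: M.a_assoc M.r_neg2)
    then show ?thesis using that assms by (auto simp: lie_coset_def intro: ideal_add ideal_uminus)
  qed
  ultimately show ?thesis by (auto simp: lie_coset_def)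
qed

lemma coset_zero: "coset \<zero> = I"
  by (simp add: lie_coset_def)

lemma coset_ideal: "n \<in> I \<Longrightarrow> coset n = I"
  using coset_absorb[of \<zero> n] by (simp add: coset_zero)

text \<open>
  Changing the representatives by elements of \<open>I\<close> changes the result by an element of \<open>I\<close>, so the
  union over all representatives is a union of equal cosets.  The same holds for scalar multiples
  and for brackets.
\<close>

lemma coset_add:
  assumes "x \<in> carrier L" "y \<in> carrier L"
  shows "coset x \<oplus>\<^bsub>Q\<^esub> coset y = coset (x \<oplus> y)"
proof -
  have "coset ((x \<oplus> m) \<oplus> (y \<oplus> n)) = coset (x \<oplus> y)" if "m \<in> I" "n \<in> I" for m n
  proof -
    have "(x \<oplus> m) \<oplus> (y \<oplus> n) = (x \<oplus> y) \<oplus> (m \<oplus> n)" using assms that by (simp add: M.a_ac)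
    then show ?thesis using assms that by (simp add: coset_absorb ideal_add)
  qed
  then show ?thesis
    using ideal_zero by (auto simp: lie_quotient_def lie_coset_def[of L I x] lie_coset_def[of L I y])
qed

lemma coset_scale:
  assumes "x \<in> carrier L"
  shows "c \<odot>\<^bsub>Q\<^esub> coset x = coset (c \<odot> x)"
proof -
  have "coset (c \<odot> (x \<oplus> m)) = coset (c \<odot> x)" if "m \<in> I" for m
    using assms that by (simp add: scale_add_right coset_absorb ideal_scale)
  then show ?thesis
    using ideal_zero by (auto simp: lie_quotient_def lie_coset_def[of L I x])
qed

lemma coset_bracket:
  assumes "x \<in> carrier L" "y \<in> carrier L"
  shows "bracket Q (coset x) (coset y) = coset (bracket L x y)"
proof -
  have "coset (bracket L (x \<oplus> m) (y \<oplus> n)) = coset (bracket L x y)" if "m \<in> I" "n \<in> I" for m n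
  proof -
    have "bracket L (x \<oplus> m) (y \<oplus> n) =
        bracket L x y \<oplus> (bracket L m y \<oplus> (bracket L x n \<oplus> bracket L m n))"
      using assms that
      by (simp add: bracket_add_left bracket_add_right bracket_closed M.a_assoc)
    then show ?thesis
      using assms that
      by (simp add: coset_absorb ideal_add ideal_bracket_left ideal_bracket_right bracket_closed)
  qed
  then show ?thesis
    using ideal_zero by (auto simp: lie_quotient_def lie_coset_def[of L I x] lie_coset_def[of L I y])
qed

lemma quotient_carrier: "carrier Q = coset ` carrier L"
  by (simp add: lie_quotient_def)

lemma quotient_zero: "\<zero>\<^bsub>Q\<^esub> = coset \<zero>"
  by (simp add: lie_quotient_def coset_zero)

lemmas quotient_simps = quotient_carrier quotient_zero coset_add coset_scale coset_bracket

text \<open>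
  All laws are inherited, because \<open>coset\<close> maps \<open>L\<close> onto the quotient and commutes with the
  operations.
\<close>

lemma lie_algebra_quotient: "lie_algebra Q"
proof -
  have "abelian_group Q"
  proof (rule abelian_groupI)
    fix X assume "X \<in> carrier Q"
    then obtain x where "x \<in> carrier L" "X = coset x" by (auto simp: quotient_carrier)
    then show "\<exists>Y\<in>carrier Q. Y \<oplus>\<^bsub>Q\<^esub> X = \<zero>\<^bsub>Q\<^esub>"
      by (intro bexI[of _ "coset (\<ominus> x)"]) (auto simp: quotient_simps M.l_neg)
  qed (auto simp: quotient_simps M.a_ac)
  then have "Module.module real_ring Q"
    by (intro moduleI cring_real_ring)
      (auto simp: quotient_simps scale_add_left scale_add_right scale_scale)
  then show ?thesis
  proof (intro lie_algebra.intro lie_algebra_axioms.intro)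
    fix X Y Z assume "X \<in> carrier Q" "Y \<in> carrier Q" "Z \<in> carrier Q"
    then show "bracket Q X (bracket Q Y Z) \<oplus>\<^bsub>Q\<^esub> bracket Q Y (bracket Q Z X)
              \<oplus>\<^bsub>Q\<^esub> bracket Q Z (bracket Q X Y) = \<zero>\<^bsub>Q\<^esub>"
      by (auto simp: quotient_simps bracket_closed jacobi)
  qed (auto simp: quotient_simps bracket_closed bracket_self bracket_add_left bracket_add_right
      bracket_smult_left bracket_smult_right)
qed

end

section \<open>Dividing by the common null space of seminorms\<close>

definition null_space :: "'a lie \<Rightarrow> ('a \<Rightarrow> real) set \<Rightarrow> 'a set" where
  "null_space L P = {x \<in> carrier L. \<forall>p\<in>P. p x = 0}"

definition quotient_seminorm :: "('a \<Rightarrow> real) \<Rightarrow> 'a set \<Rightarrow> real" where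
  "quotient_seminorm p X = the_elem (p ` X)"

locale seminormed_module = real_module L for L :: "'a lie" (structure) +
  fixes P :: "('a \<Rightarrow> real) set"
  assumes seminorms: "p \<in> P \<Longrightarrow> seminorm_on L p"

locale seminormed_lie_algebra = lie_algebra L + seminormed_module L P
  for L :: "'a lie" (structure) and P :: "('a \<Rightarrow> real) set" +
  assumes bracket_bounded: "bracket_bounded L P"
begin

text \<open>
  The bracket bounds are what makes the null space an ideal: \<open>q n = 0\<close> forces \<open>p [x, n] = 0\<close>, whatever
  the value \<open>q x\<close> is.
\<close>

lemma lie_ideal_null_space: "lie_ideal L (null_space L P)"
proof
  let ?N = "null_space L P"
  show "m \<oplus> n \<in> ?N" if "m \<in> ?N" "n \<in> ?N" for m n
  proof -
    have "p (m \<oplus> n) = 0" if p: "p \<in> P" for p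
    proof -
      have "p m = 0" "p n = 0" "m \<in> carrier L" "n \<in> carrier L"
        using \<open>m \<in> ?N\<close> \<open>n \<in> ?N\<close> p by (auto simp: null_space_def)
      then show ?thesis
        using seminorm_triangle[OF seminorms[OF p], of m n]
          seminorm_nonneg[OF seminorms[OF p], of "m \<oplus> n"] by simp
    qed
    then show ?thesis using that by (simp add: null_space_def)
  qed
  have bracket_null: "p (bracket L x y) = 0"
    if p: "p \<in> P" and xy: "x \<in> carrier L" "y \<in> carrier L" and null: "x \<in> ?N \<or> y \<in> ?N"
    for p x y
  proof -
    obtain q where q: "q \<in> P" "p (bracket L x y) \<le> q x * q y"
      using bracket_boundedE[OF bracket_bounded p] xy by metis
    moreover have "q x * q y = 0" using null q(1) by (auto simp: null_space_def)
    ultimately show ?thesis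
      using seminorm_nonneg[OF seminorms[OF p] bracket_closed[OF xy]] by linarith
  qed
  have zero: "p \<zero> = 0" and scale: "p (c \<odot> n) = \<bar>c\<bar> * p n"
    if "p \<in> P" "n \<in> carrier L" for p c n
    using that seminorm_zero[of p] seminorm_scale[of L p] by (simp_all add: seminorms)
  show "bracket L x n \<in> ?N" "bracket L n x \<in> ?N" if "x \<in> carrier L" "n \<in> ?N" for x n
    using that bracket_null by (auto simp: null_space_def bracket_closed)
  show "c \<odot> n \<in> ?N" if "n \<in> ?N" for c n
  proof -
    have "p (c \<odot> n) = 0" if p: "p \<in> P" for p
      using scale[OF p, of n c] \<open>n \<in> ?N\<close> p by (simp add: null_space_def)
    then show ?thesis using that by (simp add: null_space_def)
  qed
  show "\<zero> \<in> ?N"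
    using zero by (auto simp: null_space_def)
qed (auto simp: null_space_def)

sublocale null_space: lie_ideal L "null_space L P"
  by (rule lie_ideal_null_space)

(* As a rewrite rule it would call itself once null_space is unfolded in its premise. *)
declare null_space.ideal_carrier [simp del]

abbreviation separated_quotient :: "'a set lie" where
  "separated_quotient \<equiv> lie_quotient L (null_space L P)"

text \<open>
  Adding \<open>n\<close> to \<open>x\<close> changes the value of \<open>p\<close> by at most \<open>p n = 0\<close>, so \<open>p\<close> is constant on cosets.
\<close>

lemma quotient_seminorm_coset:
  assumes p: "p \<in> P" and x: "x \<in> carrier L"
  shows "quotient_seminorm p (null_space.coset x) = p x"
proof -
  have "p (x \<oplus> n) = p x" if n: "n \<in> null_space L P" for n
  proof -
    have n': "n \<in> carrier L" "p n = 0" using n p by (auto simp: null_space_def)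
    have "(x \<oplus> n) \<ominus> x = n"
      using x n' by (simp add: a_minus_def M.a_comm[of x n] M.r_neg M.a_assoc)
    then show ?thesis using seminorm_diff_le[OF seminorms[OF p], of "x \<oplus> n" x] x n' by simp
  qed
  then have "p ` null_space.coset x = (\<lambda>_. p x) ` null_space L P"
    by (simp add: lie_coset_def image_image cong: image_cong_simp)
  also have "\<dots> = {p x}"
    using null_space.ideal_zero by auto
  finally have "p ` null_space.coset x = {p x}" .
  then show ?thesis by (simp add: quotient_seminorm_def)
qed

lemma seminormed_lie_algebra_quotient: "seminormed_lie_algebra separated_quotient (quotient_seminorm ` P)"
proof -
  have "seminorm_on separated_quotient (quotient_seminorm p)" if p: "p \<in> P" for p
    using seminorms[OF p] p
    by (auto simp: seminorm_on_def null_space.quotient_simps quotient_seminorm_coset)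
  moreover have "bracket_bounded separated_quotient (quotient_seminorm ` P)"
    unfolding bracket_bounded_def
  proof clarify
    fix p assume p: "p \<in> P"
    obtain q where "q \<in> P"
      "\<And>x y. x \<in> carrier L \<Longrightarrow> y \<in> carrier L \<Longrightarrow> p (bracket L x y) \<le> q x * q y"
      using bracket_boundedE[OF bracket_bounded p] by metis
    then show "\<exists>q\<in>quotient_seminorm ` P. \<forall>X\<in>carrier separated_quotient. \<forall>Y\<in>carrier separated_quotient.
        quotient_seminorm p (bracket separated_quotient X Y) \<le> q X * q Y"
      using p by (intro bexI[of _ "quotient_seminorm q"])
        (auto simp: null_space.quotient_simps quotient_seminorm_coset bracket_closed)
  qed
  ultimately show ?thesis
    using null_space.lie_algebra_quotient
    by (auto intro!: seminormed_lie_algebra.intro seminormed_lie_algebra_axioms.intro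
        seminormed_module.intro seminormed_module_axioms.intro real_module.intro
        dest: lie_algebra.axioms(1))
qed

lemma quotient_separated:
  assumes "X \<in> carrier separated_quotient" "\<And>p. p \<in> P \<Longrightarrow> quotient_seminorm p X = 0"
  shows "X = \<zero>\<^bsub>separated_quotient\<^esub>"
proof -
  obtain x where x: "x \<in> carrier L" "X = null_space.coset x"
    using assms(1) by (auto simp: null_space.quotient_carrier)
  have "p x = 0" if "p \<in> P" for p
    using assms(2)[OF that] quotient_seminorm_coset[OF that x(1)] by (simp add: x(2))
  then have "x \<in> null_space L P" using x(1) by (simp add: null_space_def)
  then show ?thesis
    by (simp add: x null_space.coset_ideal null_space.quotient_zero null_space.coset_zero)
qed

end


section \<open>Topologies given by seminorms\<close>

lemma continuous_map_realI:
  fixes f :: "'a \<Rightarrow> real"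
  assumes "\<And>x e. x \<in> topspace X \<Longrightarrow> 0 < e \<Longrightarrow>
      \<exists>U. openin X U \<and> x \<in> U \<and> (\<forall>y\<in>U. \<bar>f y - f x\<bar> < e)"
  shows "continuous_map X euclideanreal f"
proof -
  have "continuous_map X Met_TC.mtopology f"
    unfolding Met_TC.continuous_map_to_metric
    using assms by (simp add: dist_real_def abs_minus_commute)
  then show ?thesis by simp
qed

context seminormed_module
begin

abbreviation T where "T \<equiv> seminorm_topology L P"

lemma topspace_seminorm_topology:
  assumes "P \<noteq> {}"
  shows "topspace T = carrier L"
proof
  show "carrier L \<subseteq> topspace T"
  proof
    fix x assume x: "x \<in> carrier L"
    obtain p where p: "p \<in> P" using assms by blast
    have "x \<in> {y \<in> carrier L. p (y \<ominus> x) < 1}"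
      using x seminorm_zero[OF seminorms[OF p]] by simp
    moreover have "openin T {y \<in> carrier L. p (y \<ominus> x) < 1}"
      unfolding seminorm_topology_def using p x
      by (intro topology_generated_by_Basis CollectI exI[of _ p] exI[of _ x] exI[of _ 1]) simp
    ultimately show "x \<in> topspace T" using openin_subset by blast
  qed
qed (auto simp: seminorm_topology_def)

lemma openin_semiball:
  assumes "p \<in> P" "x \<in> carrier L"
  shows "openin T {y \<in> carrier L. p (y \<ominus> x) < e}"
proof (cases "0 < e")
  case True
  then show ?thesis
    unfolding seminorm_topology_def using assms by (intro topology_generated_by_Basis) blast
next
  case False
  have "0 \<le> p (y \<ominus> x)" if "y \<in> carrier L" for y
    using seminorm_nonneg[OF seminorms[OF assms(1)], of "y \<ominus> x"] that assms(2) by simp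
  then have "{y \<in> carrier L. p (y \<ominus> x) < e} = {}"
    using False by fastforce
  then show ?thesis by (simp only: openin_empty)
qed

lemma continuous_map_seminorm_minus:
  assumes P: "P \<noteq> {}" and p: "p \<in> P" and z: "z \<in> carrier L"
  shows "continuous_map T euclideanreal (\<lambda>x. p (x \<ominus> z))"
proof (rule continuous_map_realI)
  fix x e :: real assume "0 < e"
  fix x assume x: "x \<in> topspace T"
  then have xL: "x \<in> carrier L" by (simp add: topspace_seminorm_topology P)
  have "\<bar>p (y \<ominus> z) - p (x \<ominus> z)\<bar> < e" if y: "y \<in> carrier L" "p (y \<ominus> x) < e" for y
    using seminorm_minus_triangle[OF seminorms[OF p] y(1) xL z]
      seminorm_minus_triangle[OF seminorms[OF p] xL y(1) z]
      seminorm_minus_commute[OF seminorms[OF p] y(1) xL] y(2)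
    by linarith
  then show "\<exists>U. openin T U \<and> x \<in> U \<and> (\<forall>y\<in>U. \<bar>p (y \<ominus> z) - p (x \<ominus> z)\<bar> < e)"
    using openin_semiball[OF p xL, of e] xL \<open>0 < e\<close> seminorm_zero[OF seminorms[OF p]]
    by (intro exI[of _ "{y \<in> carrier L. p (y \<ominus> x) < e}"]) simp
qed

text \<open>
  Continuity into a seminorm topology can be tested by a majorant \<open>g\<close>: near \<open>x\<close> the image \<open>f y\<close> stays in
  the semiball of radius \<open>e\<close> around \<open>z\<close> as long as \<open>g y\<close> is below the gap \<open>e - p (f x - z)\<close>, which is
  positive when \<open>f x\<close> lies in that semiball.
\<close>

lemma continuous_map_seminorm_topologyI:
  assumes carrier: "\<And>x. x \<in> topspace X \<Longrightarrow> f x \<in> carrier L"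
    and majorant: "\<And>p x. p \<in> P \<Longrightarrow> x \<in> topspace X \<Longrightarrow>
      \<exists>g. continuous_map X euclideanreal g \<and> g x = 0 \<and>
          (\<forall>y\<in>topspace X. p (f y \<ominus> f x) \<le> g y)"
    and P: "P \<noteq> {}"
  shows "continuous_map X T f"
proof -
  have "openin X (f -` {y \<in> carrier L. p (y \<ominus> z) < e} \<inter> topspace X)"
    if p: "p \<in> P" and z: "z \<in> carrier L" for p z e
  proof (subst openin_subopen, intro ballI)
    fix x assume "x \<in> f -` {y \<in> carrier L. p (y \<ominus> z) < e} \<inter> topspace X"
    then have x: "x \<in> topspace X" and less: "p (f x \<ominus> z) < e" by auto
    obtain g where g: "continuous_map X euclideanreal g" "g x = 0"
        "\<forall>y\<in>topspace X. p (f y \<ominus> f x) \<le> g y"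
      using majorant[OF p x] by blast
    let ?U = "{y \<in> topspace X. g y < e - p (f x \<ominus> z)}"
    have "openin X ?U"
      using g(1) by (simp add: continuous_map_upper_lower_semicontinuous_lt)
    moreover have "p (f y \<ominus> z) < e" if "y \<in> ?U" for y
      using seminorm_minus_triangle[OF seminorms[OF p] carrier[of y] carrier[OF x] z] g(3) that
      by fastforce
    ultimately show "\<exists>U. openin X U \<and> x \<in> U \<and> U \<subseteq> f -` {y \<in> carrier L. p (y \<ominus> z) < e} \<inter> topspace X"
      using x less g(2) carrier by (intro exI[of _ ?U]) auto
  qed
  moreover have "f ` topspace X \<subseteq> topspace T"
    using carrier by (auto simp: topspace_seminorm_topology P)
  ultimately show ?thesis
    unfolding seminorm_topology_def
    by (intro continuous_on_generated_topo) auto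
qed

lemma Hausdorff_seminorm_topology:
  assumes P: "P \<noteq> {}"
    and separating: "\<And>x. x \<in> carrier L \<Longrightarrow> \<forall>p\<in>P. p x = 0 \<Longrightarrow> x = \<zero>"
  shows "Hausdorff_space T"
  unfolding Hausdorff_space_def topspace_seminorm_topology[OF P]
proof clarify
  fix x y assume xy: "x \<in> carrier L" "y \<in> carrier L" "x \<noteq> y"
  have "x \<ominus> y \<noteq> \<zero>" using add_minus_cancel[OF xy(1,2)] xy by auto
  then obtain p where p: "p \<in> P" and "p (x \<ominus> y) \<noteq> 0"
    using separating[of "x \<ominus> y"] xy by auto
  define d where "d = p (x \<ominus> y)"
  have "0 < d"
    using seminorm_nonneg[OF seminorms[OF p], of "x \<ominus> y"] \<open>p (x \<ominus> y) \<noteq> 0\<close> xy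
    by (simp add: d_def)
  have "\<not> p (z \<ominus> y) < d / 2" if "z \<in> carrier L" "p (z \<ominus> x) < d / 2" for z
    using seminorm_minus_triangle[OF seminorms[OF p] xy(1) that(1) xy(2)]
      seminorm_minus_commute[OF seminorms[OF p] that(1) xy(1)] that(2)
    by (simp add: d_def)
  then show "\<exists>U V. openin T U \<and> openin T V \<and> x \<in> U \<and> y \<in> V \<and> disjnt U V"
    using openin_semiball[OF p, of x "d / 2"] openin_semiball[OF p, of y "d / 2"] xy \<open>0 < d\<close>
      seminorm_zero[OF seminorms[OF p]]
    by (intro exI[of _ "{z \<in> carrier L. p (z \<ominus> x) < d / 2}"]
        exI[of _ "{z \<in> carrier L. p (z \<ominus> y) < d / 2}"]) (auto simp: disjnt_def)
qed

text \<open>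
  The semiballs in the subbase have arbitrary centres; recentring at \<open>x\<close> is possible by the triangle
  inequality.
\<close>

lemma finite_semiballs_in_open:
  assumes "openin T W" "x \<in> W"
  obtains F e where "finite F" "F \<subseteq> P" "0 < e"
    "{y \<in> carrier L. \<forall>p\<in>F. p (y \<ominus> x) < e} \<subseteq> W"
proof -
  let ?nbhd = "\<lambda>W F e. finite F \<and> F \<subseteq> P \<and> 0 < e \<and> {y \<in> carrier L. \<forall>p\<in>F. p (y \<ominus> x) < e} \<subseteq> W"
  have "generate_topology_on
     {{y \<in> carrier L. p (y \<ominus> x) < e} | p x e. p \<in> P \<and> x \<in> carrier L \<and> 0 < (e::real)} W"
    using assms(1) unfolding seminorm_topology_def openin_topology_generated_by_iff .
  then have "x \<in> W \<longrightarrow> (\<exists>F e. ?nbhd W F e)"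
  proof induction
    case (Int A B)
    show ?case
    proof
      assume "x \<in> A \<inter> B"
      then obtain F e G d where "?nbhd A F e" "?nbhd B G d" using Int by blast
      then have "?nbhd (A \<inter> B) (F \<union> G) (min e d)" by auto
      then show "\<exists>F e. ?nbhd (A \<inter> B) F e" by blast
    qed
  next
    case (UN K)
    then show ?case by (meson Sup_upper UnionE order_trans)
  next
    case (Basis S)
    show ?case
    proof
      assume "x \<in> S"
      obtain p z e where S: "S = {y \<in> carrier L. p (y \<ominus> z) < e}" "p \<in> P" "z \<in> carrier L"
        using Basis by blast
      have "p (y \<ominus> z) < e" if "y \<in> carrier L" "p (y \<ominus> x) < e - p (x \<ominus> z)" for y
        using seminorm_minus_triangle[OF seminorms[OF S(2)] that(1) _ S(3), of x] that \<open>x \<in> S\<close> S(1)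
        by auto
      then have "?nbhd S {p} (e - p (x \<ominus> z))" using S \<open>x \<in> S\<close> by auto
      then show "\<exists>F e. ?nbhd S F e" by blast
    qed
  qed simp
  then show thesis using assms(2) that by blast
qed

lemma convex_base_seminorm_topology:
  assumes P: "P \<noteq> {}"
  shows "neighbourhood_base_at \<zero> (convex_in L) T"
  unfolding neighbourhood_base_at_def
proof clarify
  fix W assume "openin T W" "\<zero> \<in> W"
  then obtain F e where F: "finite F" "F \<subseteq> P" "0 < e"
    "{y \<in> carrier L. \<forall>p\<in>F. p (y \<ominus> \<zero>) < e} \<subseteq> W"
    by (rule finite_semiballs_in_open)
  let ?V = "{y \<in> carrier L. \<forall>p\<in>F. p (y \<ominus> \<zero>) < e}"
  have minus_zero: "y \<ominus> \<zero> = y" if "y \<in> carrier L" for y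
    using that add_minus_cancel[of y \<zero>] by simp
  have "?V = topspace T \<inter> \<Inter>((\<lambda>p. {y \<in> carrier L. p (y \<ominus> \<zero>) < e}) ` F)"
    by (auto simp: topspace_seminorm_topology P)
  moreover have "openin T (topspace T \<inter> \<Inter>((\<lambda>p. {y \<in> carrier L. p (y \<ominus> \<zero>) < e}) ` F))"
    using F by (intro openin_Int_Inter) (auto intro!: openin_semiball)
  ultimately have "openin T ?V" by simp
  moreover have "convex_in L ?V"
    unfolding convex_in_def
  proof (intro conjI ballI allI impI)
    fix x y u v assume x: "x \<in> ?V" and y: "y \<in> ?V" and uv: "0 \<le> u" "0 \<le> v" "u + v = (1::real)"
    have "p (u \<odot> x \<oplus> v \<odot> y) < e" if p: "p \<in> F" for p
    proof -
      have sp: "seminorm_on L p" using seminorms p F(2) by blast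
      have "p (u \<odot> x \<oplus> v \<odot> y) \<le> u * p x + v * p y"
        using seminorm_triangle[OF sp, of "u \<odot> x" "v \<odot> y"] seminorm_scale[OF sp] x y uv by simp
      also have "\<dots> < e"
        using x y p uv minus_zero by (intro convex_bound_lt) auto
      finally show ?thesis .
    qed
    then show "u \<odot> x \<oplus> v \<odot> y \<in> ?V" using x y by (simp add: minus_zero)
  qed simp
  moreover have "\<zero> \<in> ?V"
  proof -
    have "p (\<zero> \<ominus> \<zero>) < e" if "p \<in> F" for p
      using that F(2,3) seminorm_zero[of p] seminorms[of p] by auto
    then show ?thesis by simp
  qed
  ultimately show "\<exists>U V. openin T U \<and> convex_in L V \<and> \<zero> \<in> U \<and> U \<subseteq> V \<and> V \<subseteq> W"
    using F(4) by blast
qed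

lemma locally_convex_space_seminorm_topology:
  assumes P: "P \<noteq> {}"
    and separating: "\<And>x. x \<in> carrier L \<Longrightarrow> \<forall>p\<in>P. p x = 0 \<Longrightarrow> x = \<zero>"
  shows "locally_convex_space L T"
  unfolding locally_convex_space_def
proof (intro conjI)
  note top = topspace_seminorm_topology[OF P]
  note cont = continuous_map_seminorm_minus[OF P]
  show "continuous_map (prod_topology T T) T (\<lambda>(x, y). x \<oplus> y)"
  proof (rule continuous_map_seminorm_topologyI[OF _ _ P])
    fix p z assume p: "p \<in> P" and "z \<in> topspace (prod_topology T T)"
    then obtain a b where ab: "a \<in> carrier L" "b \<in> carrier L" "z = (a, b)" by (auto simp: top)
    let ?g = "\<lambda>w. p (fst w \<ominus> a) + p (snd w \<ominus> b)"
    have "continuous_map (prod_topology T T) euclideanreal ?g"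
      using continuous_map_compose[OF continuous_map_fst cont[OF p ab(1)]]
        continuous_map_compose[OF continuous_map_snd cont[OF p ab(2)]]
      by (intro continuous_intros) (simp_all add: o_def)
    moreover have "p ((x \<oplus> y) \<ominus> (a \<oplus> b)) \<le> ?g (x, y)" if "x \<in> carrier L" "y \<in> carrier L" for x y
    proof -
      have "(x \<oplus> y) \<ominus> (a \<oplus> b) = (x \<ominus> a) \<oplus> (y \<ominus> b)"
        using that ab by (simp add: a_minus_def M.minus_add M.a_ac)
      then show ?thesis
        using seminorm_triangle[OF seminorms[OF p], of "x \<ominus> a" "y \<ominus> b"] that ab
        by simp
    qed
    ultimately show "\<exists>g. continuous_map (prod_topology T T) euclideanreal g \<and> g z = 0 \<and>
          (\<forall>w\<in>topspace (prod_topology T T).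
              p ((case w of (x, y) \<Rightarrow> x \<oplus> y) \<ominus> (case z of (x, y) \<Rightarrow> x \<oplus> y)) \<le> g w)"
      using ab seminorm_zero[OF seminorms[OF p]] by (intro exI[of _ ?g]) (auto simp: top)
  qed (auto simp: top)
  show "continuous_map (prod_topology euclideanreal T) T (\<lambda>(c, x). c \<odot> x)"
  proof (rule continuous_map_seminorm_topologyI[OF _ _ P])
    fix p z assume p: "p \<in> P" and "z \<in> topspace (prod_topology euclideanreal T)"
    then obtain d a where a: "a \<in> carrier L" "z = (d, a)" by (auto simp: top)
    let ?g = "\<lambda>w. \<bar>fst w - d\<bar> * p (snd w \<ominus> a) + \<bar>fst w - d\<bar> * p a + \<bar>d\<bar> * p (snd w \<ominus> a)"
    have "continuous_map (prod_topology euclideanreal T) euclideanreal ?g"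
      using continuous_map_compose[OF continuous_map_snd cont[OF p a(1)]]
        continuous_map_fst[of euclideanreal T]
      by (intro continuous_intros) (simp_all add: o_def)
    moreover have "p (c \<odot> x \<ominus> d \<odot> a) \<le> ?g (c, x)" if x: "x \<in> carrier L" for c x
    proof -
      define h where "h = x \<ominus> a"
      have h: "h \<in> carrier L" "x = h \<oplus> a"
        using x a by (simp_all add: h_def add_minus_cancel)
      have "c \<odot> x = (c - d) \<odot> h \<oplus> (c - d) \<odot> a \<oplus> d \<odot> h \<oplus> d \<odot> a"
        using h a scale_add_left[of h "c - d" d] scale_add_left[of a "c - d" d]
        by (simp add: scale_add_right M.a_ac)
      then have "c \<odot> x \<ominus> d \<odot> a = (c - d) \<odot> h \<oplus> (c - d) \<odot> a \<oplus> d \<odot> h"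
        using h a by (simp add: a_minus_def M.a_assoc M.r_neg)
      then show ?thesis
        using seminorm_triangle[OF seminorms[OF p], of "(c - d) \<odot> h \<oplus> (c - d) \<odot> a" "d \<odot> h"]
          seminorm_triangle[OF seminorms[OF p], of "(c - d) \<odot> h" "(c - d) \<odot> a"] h(1) a
        by (simp add: seminorm_scale[OF seminorms[OF p]] flip: h_def)
    qed
    ultimately show "\<exists>g. continuous_map (prod_topology euclideanreal T) euclideanreal g \<and> g z = 0 \<and>
          (\<forall>w\<in>topspace (prod_topology euclideanreal T).
              p ((case w of (c, x) \<Rightarrow> c \<odot> x) \<ominus> (case z of (c, x) \<Rightarrow> c \<odot> x)) \<le> g w)"
      using a seminorm_zero[OF seminorms[OF p]] by (intro exI[of _ ?g]) (auto simp: top)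
  qed (auto simp: top)
qed (use P separating topspace_seminorm_topology Hausdorff_seminorm_topology
      convex_base_seminorm_topology module_axioms in auto)

end

text \<open>
  With \<open>x = h + a\<close> and \<open>y = k + b\<close>, the difference of \<open>[x, y]\<close> and \<open>[a, b]\<close> is
  \<open>[h, k] + [h, b] + [a, k]\<close>, and a bound for the bracket turns these terms into a continuous majorant
  vanishing at \<open>(a, b)\<close>.
\<close>

lemma (in seminormed_lie_algebra) locally_convex_lie_algebra_seminorm_topology:
  assumes P: "P \<noteq> {}"
    and separating: "\<And>x. x \<in> carrier L \<Longrightarrow> \<forall>p\<in>P. p x = 0 \<Longrightarrow> x = \<zero>"
  shows "locally_convex_lie_algebra L (seminorm_topology L P)"
  unfolding locally_convex_lie_algebra_def
proof (intro conjI)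
  show "locally_convex_space L T"
    using P separating by (rule locally_convex_space_seminorm_topology)
  show "lie_algebra L" by (rule lie_algebra_axioms)
  note top = topspace_seminorm_topology[OF P]
  note cont = continuous_map_seminorm_minus[OF P]
  show "continuous_map (prod_topology T T) T (\<lambda>(x, y). bracket L x y)"
  proof (rule continuous_map_seminorm_topologyI[OF _ _ P])
    fix p z assume p: "p \<in> P" and "z \<in> topspace (prod_topology T T)"
    then obtain a b where ab: "a \<in> carrier L" "b \<in> carrier L" "z = (a, b)" by (auto simp: top)
    obtain q where q: "q \<in> P"
      "\<And>x y. x \<in> carrier L \<Longrightarrow> y \<in> carrier L \<Longrightarrow> p (bracket L x y) \<le> q x * q y"
      using bracket_boundedE[OF bracket_bounded p] by metis
    let ?g = "\<lambda>w. q (fst w \<ominus> a) * q (snd w \<ominus> b) + q (fst w \<ominus> a) * q b + q a * q (snd w \<ominus> b)"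
    have "continuous_map (prod_topology T T) euclideanreal ?g"
      using continuous_map_compose[OF continuous_map_fst cont[OF q(1) ab(1)]]
        continuous_map_compose[OF continuous_map_snd cont[OF q(1) ab(2)]]
      by (intro continuous_intros) (simp_all add: o_def)
    moreover have "p (bracket L x y \<ominus> bracket L a b) \<le> ?g (x, y)"
      if xy: "x \<in> carrier L" "y \<in> carrier L" for x y
    proof -
      define h k where "h = x \<ominus> a" and "k = y \<ominus> b"
      have h: "h \<in> carrier L" "x = h \<oplus> a" and k: "k \<in> carrier L" "y = k \<oplus> b"
        using xy ab by (simp_all add: h_def k_def add_minus_cancel)
      have "bracket L x y =
          bracket L h k \<oplus> bracket L h b \<oplus> bracket L a k \<oplus> bracket L a b"
        using h k ab
        by (simp add: bracket_add_left bracket_add_right bracket_closed M.a_ac)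
      then have "bracket L x y \<ominus> bracket L a b = bracket L h k \<oplus> bracket L h b \<oplus> bracket L a k"
        using h k ab by (simp add: a_minus_def M.a_assoc M.r_neg bracket_closed)
      then have "p (bracket L x y \<ominus> bracket L a b) \<le>
          p (bracket L h k) + p (bracket L h b) + p (bracket L a k)"
        using seminorm_triangle[OF seminorms[OF p], of "bracket L h k \<oplus> bracket L h b" "bracket L a k"]
          seminorm_triangle[OF seminorms[OF p], of "bracket L h k" "bracket L h b"] h k ab
        by (simp add: bracket_closed)
      also have "\<dots> \<le> q h * q k + q h * q b + q a * q k"
        using q(2) h k ab by (intro add_mono) auto
      finally show ?thesis by (simp add: h_def k_def)
    qed
    ultimately show "\<exists>g. continuous_map (prod_topology T T) euclideanreal g \<and> g z = 0 \<and>
          (\<forall>w\<in>topspace (prod_topology T T).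
              p ((case w of (x, y) \<Rightarrow> bracket L x y) \<ominus> (case z of (x, y) \<Rightarrow> bracket L x y)) \<le> g w)"
      using ab seminorm_zero[OF seminorms[OF q(1)]] by (intro exI[of _ ?g]) (auto simp: top)
  qed (auto simp: top bracket_closed)
qed


section \<open>Continuous seminorms from convex neighbourhoods\<close>

text \<open>
  The Minkowski functional of \<open>C\<close>.
\<close>

definition gauge_in :: "'a lie \<Rightarrow> 'a set \<Rightarrow> 'a \<Rightarrow> real" where
  "gauge_in L C x = Inf {t. 0 < t \<and> inverse t \<odot>\<^bsub>L\<^esub> x \<in> C}"

context real_module
begin

context
  fixes C :: "'a set"
  assumes convex: "convex_in L C" and zero: "\<zero> \<in> C"
    and absorbing: "\<And>x. x \<in> carrier L \<Longrightarrow> \<exists>t>0. inverse t \<odot> x \<in> C"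
begin

lemma convexD:
  "x \<in> C \<Longrightarrow> y \<in> C \<Longrightarrow> 0 \<le> u \<Longrightarrow> 0 \<le> v \<Longrightarrow> u + v = 1 \<Longrightarrow> u \<odot> x \<oplus> v \<odot> y \<in> C"
  using convex by (simp add: convex_in_def)

lemma gauge_le:
  assumes "0 < t" "inverse t \<odot> x \<in> C"
  shows "gauge_in L C x \<le> t"
  unfolding gauge_in_def using assms by (intro cInf_lower bdd_belowI[of _ 0]) auto

lemma gauge_nonneg: "x \<in> carrier L \<Longrightarrow> 0 \<le> gauge_in L C x"
  unfolding gauge_in_def using absorbing by (intro cInf_greatest) auto

text \<open>
  The admissible scales form an up-set: if \<open>x / t\<close> lies in \<open>C\<close> and \<open>t < s\<close>, then \<open>x / s\<close> is a convex
  combination of \<open>x / t\<close> and zero.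
\<close>

lemma gauge_less:
  assumes x: "x \<in> carrier L" and less: "gauge_in L C x < s"
  shows "0 < s" "inverse s \<odot> x \<in> C"
proof -
  have "bdd_below {t. 0 < t \<and> inverse t \<odot> x \<in> C}" by (rule bdd_belowI[of _ 0]) auto
  moreover have "{t. 0 < t \<and> inverse t \<odot> x \<in> C} \<noteq> {}" using absorbing[OF x] by blast
  ultimately obtain t where t: "0 < t" "inverse t \<odot> x \<in> C" "t < s"
    using less cInf_less_iff[of "{t. 0 < t \<and> inverse t \<odot> x \<in> C}" s]
    by (auto simp: gauge_in_def)
  then show "0 < s" by simp
  have "(t / s) \<odot> (inverse t \<odot> x) \<oplus> (1 - t / s) \<odot> \<zero> \<in> C"
    using t zero by (intro convexD) auto
  moreover have "t / s * inverse t = inverse s" using t by (simp add: field_simps)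
  ultimately show "inverse s \<odot> x \<in> C"
    using x by (simp add: scale_scale)
qed

text \<open>
  For admissible scales \<open>s\<close> of \<open>x\<close> and \<open>t\<close> of \<open>y\<close>, the vector \<open>(x + y) / (s + t)\<close> is the convex combination
  of \<open>x / s\<close> and \<open>y / t\<close> with weights \<open>s / (s + t)\<close> and \<open>t / (s + t)\<close>.
\<close>

lemma gauge_triangle:
  assumes x: "x \<in> carrier L" and y: "y \<in> carrier L"
  shows "gauge_in L C (x \<oplus> y) \<le> gauge_in L C x + gauge_in L C y"
proof (rule field_le_epsilon)
  fix e :: real assume "0 < e"
  define s t where "s = gauge_in L C x + e / 2" and "t = gauge_in L C y + e / 2"
  have s: "0 < s" "inverse s \<odot> x \<in> C" and t: "0 < t" "inverse t \<odot> y \<in> C"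
    using gauge_less[OF x, of s] gauge_less[OF y, of t] \<open>0 < e\<close> by (simp_all add: s_def t_def)
  have "(s / (s + t)) \<odot> (inverse s \<odot> x) \<oplus> (t / (s + t)) \<odot> (inverse t \<odot> y) \<in> C"
  proof -
    have "s / (s + t) + t / (s + t) = 1" using s(1) t(1) by (simp flip: add_divide_distrib)
    then show ?thesis using s t by (intro convexD) auto
  qed
  moreover have "s / (s + t) * inverse s = inverse (s + t)" "t / (s + t) * inverse t = inverse (s + t)"
    using s(1) t(1) by (simp_all add: field_simps)
  ultimately have "inverse (s + t) \<odot> (x \<oplus> y) \<in> C"
    using x y by (simp add: scale_scale scale_add_right)
  then show "gauge_in L C (x \<oplus> y) \<le> gauge_in L C x + gauge_in L C y + e"
    using gauge_le[of "s + t" "x \<oplus> y"] s(1) t(1) by (simp add: s_def t_def)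
qed

lemma gauge_scale_le:
  assumes x: "x \<in> carrier L" and c: "0 < c"
  shows "gauge_in L C (c \<odot> x) \<le> c * gauge_in L C x"
proof (rule field_le_epsilon)
  fix e :: real assume "0 < e"
  define s where "s = gauge_in L C x + e / c"
  have s: "0 < s" "inverse s \<odot> x \<in> C"
    using gauge_less[OF x, of s] \<open>0 < e\<close> c by (simp_all add: s_def)
  moreover have "inverse (c * s) * c = inverse s" using c by simp
  ultimately have "inverse (c * s) \<odot> (c \<odot> x) \<in> C"
    using x by (simp add: scale_scale del: inverse_mult_distrib)
  then have "gauge_in L C (c \<odot> x) \<le> c * s"
    using s(1) c by (intro gauge_le) auto
  also have "c * s = c * gauge_in L C x + e"
    using c by (simp add: s_def distrib_left)
  finally show "gauge_in L C (c \<odot> x) \<le> c * gauge_in L C x + e" .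
qed

lemma gauge_scale_pos:
  assumes x: "x \<in> carrier L" and c: "0 < c"
  shows "gauge_in L C (c \<odot> x) = c * gauge_in L C x"
proof (rule antisym)
  have "gauge_in L C (inverse c \<odot> (c \<odot> x)) \<le> inverse c * gauge_in L C (c \<odot> x)"
    using x c by (intro gauge_scale_le) auto
  then show "c * gauge_in L C x \<le> gauge_in L C (c \<odot> x)"
    using x c by (simp add: scale_scale field_simps)
qed (use assms in \<open>rule gauge_scale_le\<close>)

lemma gauge_zero: "gauge_in L C \<zero> = 0"
proof (rule antisym)
  have "gauge_in L C \<zero> \<le> 0 + e" if "0 < e" for e
    using that zero by (simp add: gauge_le)
  then show "gauge_in L C \<zero> \<le> 0" by (rule field_le_epsilon)
qed (simp add: gauge_nonneg)

lemma seminorm_gauge: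
  assumes symmetric: "\<And>x. x \<in> C \<Longrightarrow> \<ominus> x \<in> C"
  shows "seminorm_on L (gauge_in L C)"
proof -
  have in_carrier: "x \<in> carrier L" if "x \<in> C" for x using convex that by (auto simp: convex_in_def)
  have minus: "gauge_in L C ((- 1) \<odot> x) = gauge_in L C x" if x: "x \<in> carrier L" for x
  proof -
    have "inverse t \<odot> ((- 1) \<odot> x) = \<ominus> (inverse t \<odot> x)" for t
      using x scale_scale[of x "- 1" "inverse t"] scale_scale[of x "inverse t" "- 1"]
      by (simp flip: scale_minus_one)
    moreover have "\<ominus> y \<in> C \<longleftrightarrow> y \<in> C" if "y \<in> carrier L" for y
      using symmetric[of y] symmetric[of "\<ominus> y"] that by auto
    ultimately show ?thesis using x by (simp add: gauge_in_def)
  qed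
  have "gauge_in L C (c \<odot> x) = \<bar>c\<bar> * gauge_in L C x" if x: "x \<in> carrier L" for c x
  proof (cases "c = 0")
    case True
    then show ?thesis using x by (simp add: gauge_zero)
  next
    case False
    show ?thesis
    proof (cases "0 < c")
      case True
      then show ?thesis using x by (simp add: gauge_scale_pos)
    next
      case neg: False
      have "c \<odot> x = (- 1) \<odot> ((- c) \<odot> x)" using x by (simp add: scale_scale)
      then show ?thesis using neg False x by (simp add: minus gauge_scale_pos)
    qed
  qed
  then show ?thesis
    by (simp add: seminorm_on_def gauge_nonneg gauge_triangle)
qed

end

lemma continuous_map_scale:
  assumes "locally_convex_space L T"
  shows "continuous_map T T (\<lambda>x. c \<odot> x)"
    and "x \<in> carrier L \<Longrightarrow> continuous_map euclideanreal T (\<lambda>t. t \<odot> x)"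
proof -
  have cont: "continuous_map (prod_topology euclideanreal T) T (\<lambda>(c, x). c \<odot> x)"
    and top: "topspace T = carrier L"
    using assms by (auto simp: locally_convex_space_def)
  have "continuous_map T (prod_topology euclideanreal T) (\<lambda>x. (c, x))"
    by (intro continuous_map_pairedI) auto
  from continuous_map_compose[OF this cont] show "continuous_map T T (\<lambda>x. c \<odot> x)"
    by (simp add: o_def)
  assume "x \<in> carrier L"
  then have "continuous_map euclideanreal (prod_topology euclideanreal T) (\<lambda>t. (t, x))"
    by (intro continuous_map_pairedI) (auto simp: top)
  from continuous_map_compose[OF this cont]
  show "continuous_map euclideanreal T (\<lambda>t. t \<odot> x)" by (simp add: o_def)
qed

text \<open>
  A seminorm bounded near zero is continuous: translate and rescale the neighbourhood of zero, and
  use \<open>\<bar>p x - p y\<bar> \<le> p (x - y)\<close>.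
\<close>

lemma continuous_map_seminorm:
  assumes lcs: "locally_convex_space L T" and p: "seminorm_on L p"
    and U: "openin T U" "\<zero> \<in> U" "\<And>x. x \<in> U \<Longrightarrow> p x \<le> 1"
  shows "continuous_map T euclideanreal p"
proof (rule continuous_map_realI)
  have add: "continuous_map (prod_topology T T) T (\<lambda>(x, y). x \<oplus> y)"
    and top: "topspace T = carrier L"
    using lcs by (auto simp: locally_convex_space_def)
  fix x0 and e :: real assume "x0 \<in> topspace T" and e: "0 < e"
  then have x0: "x0 \<in> carrier L" by (simp add: top)
  \<comment> \<open>The factor 2 makes the bound strict: it yields \<open>p (x - x0) \<le> e / 2\<close>.\<close>
  let ?f = "\<lambda>x. (2 / e) \<odot> (x \<ominus> x0)"
  have "continuous_map T (prod_topology T T) (\<lambda>x. (x, \<ominus> x0))"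
    using x0 by (intro continuous_map_pairedI) (auto simp: top)
  from continuous_map_compose[OF continuous_map_compose[OF this add] continuous_map_scale(1)[OF lcs]]
  have "continuous_map T T ?f" by (simp add: o_def a_minus_def)
  then have "openin T {x \<in> topspace T. ?f x \<in> U}"
    using U(1) by (simp add: openin_continuous_map_preimage)
  moreover have "\<bar>p x - p x0\<bar> < e" if x: "x \<in> carrier L" "?f x \<in> U" for x
  proof -
    have "2 / e * p (x \<ominus> x0) \<le> 1"
      using U(3)[OF x(2)] seminorm_scale[OF p, of "x \<ominus> x0" "2 / e"] x x0 e by simp
    then have "p (x \<ominus> x0) < e" using e by (simp add: field_simps)
    then show ?thesis using seminorm_diff_le[OF p x(1) x0] by simp
  qed
  ultimately show "\<exists>V. openin T V \<and> x0 \<in> V \<and> (\<forall>x\<in>V. \<bar>p x - p x0\<bar> < e)"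
    using x0 U(2) by (intro exI[of _ "{x \<in> topspace T. ?f x \<in> U}"]) (auto simp: top)
qed

text \<open>
  Convex neighbourhoods supply continuous seminorms: the gauge of the symmetric part of a convex
  neighbourhood inside \<open>U\<close>.  The condition on \<open>q\<close> says that the open unit ball of \<open>q\<close> lies in \<open>U\<close>, in a
  form that has the rescaling built in.
\<close>

lemma seminorm_in_neighbourhood:
  assumes lcs: "locally_convex_space L T" and U: "openin T U" "\<zero> \<in> U"
  obtains q where "q \<in> cont_seminorms L T"
    "\<And>x s. x \<in> carrier L \<Longrightarrow> q x < s \<Longrightarrow> 0 < s \<and> inverse s \<odot> x \<in> U"
proof -
  have top: "topspace T = carrier L" using lcs by (simp add: locally_convex_space_def)
  obtain V C where V: "openin T V" "\<zero> \<in> V" "V \<subseteq> C" and C: "convex_in L C" "C \<subseteq> U"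
    using lcs U unfolding locally_convex_space_def neighbourhood_base_at_def by metis
  define D where "D = {x \<in> C. \<ominus> x \<in> C}"
  define W where "W = {x \<in> topspace T. (- 1) \<odot> x \<in> V} \<inter> V"
  have CL: "C \<subseteq> carrier L" using C(1) by (simp add: convex_in_def)
  have "openin T W"
    unfolding W_def using V(1) continuous_map_scale(1)[OF lcs]
    by (intro openin_Int openin_continuous_map_preimage)
  have "\<zero> \<in> W" using V(2) by (simp add: W_def top)
  have "W \<subseteq> D" using V(3) by (auto simp: W_def D_def top scale_minus_one)
  have convex: "convex_in L D"
  proof -
    have "\<ominus> (u \<odot> x \<oplus> v \<odot> y) = u \<odot> (\<ominus> x) \<oplus> v \<odot> (\<ominus> y)" if "x \<in> D" "y \<in> D" for u v x y
      using that CL scale_scale[of x "- 1" u] scale_scale[of x u "- 1"]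
        scale_scale[of y "- 1" v] scale_scale[of y v "- 1"]
      by (auto simp: D_def subset_iff scale_add_right simp flip: scale_minus_one)
    then show ?thesis using C(1) CL by (auto simp: convex_in_def D_def)
  qed
  have zero: "\<zero> \<in> D" using \<open>\<zero> \<in> W\<close> \<open>W \<subseteq> D\<close> by blast
  have absorbing: "\<exists>t>0. inverse t \<odot> x \<in> D" if x: "x \<in> carrier L" for x
  proof -
    have "open {t. t \<odot> x \<in> W}"
      using openin_continuous_map_preimage[OF continuous_map_scale(2)[OF lcs x] \<open>openin T W\<close>]
      by simp
    moreover have "(0::real) \<in> {t. t \<odot> x \<in> W}" using x \<open>\<zero> \<in> W\<close> by simp
    ultimately obtain r where r: "0 < r" "\<And>t. dist t 0 < r \<Longrightarrow> t \<odot> x \<in> W"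
      unfolding open_dist by blast
    have "inverse (2 / r) \<odot> x \<in> W" using r(1) by (intro r(2)) (simp add: dist_real_def)
    then show ?thesis using r(1) \<open>W \<subseteq> D\<close> by (intro exI[of _ "2 / r"]) auto
  qed
  define g where "g = gauge_in L D"
  have g: "seminorm_on L g"
    unfolding g_def using CL
    by (intro seminorm_gauge convex zero absorbing) (auto simp: D_def)
  have "g x \<le> 1" if "x \<in> W" for x
    unfolding g_def using that \<open>W \<subseteq> D\<close> openin_subset[OF \<open>openin T W\<close>]
    by (intro gauge_le[OF convex zero absorbing]) (auto simp: top subset_iff)
  then have "continuous_map T euclideanreal g"
    using continuous_map_seminorm[OF lcs g \<open>openin T W\<close> \<open>\<zero> \<in> W\<close>] by blast
  then have "continuous_map T euclideanreal (restrict g (carrier L))"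
    by (rule continuous_map_eq) (simp add: top)
  moreover have "seminorm_on L (restrict g (carrier L))"
    using g by (simp add: seminorm_on_def)
  ultimately have "restrict g (carrier L) \<in> cont_seminorms L T"
    by (simp add: cont_seminorms_def)
  moreover have "0 < s \<and> inverse s \<odot> x \<in> U"
    if "x \<in> carrier L" "restrict g (carrier L) x < s" for x s
    using gauge_less[OF convex zero absorbing, of x s] that C(2) by (auto simp: g_def D_def)
  ultimately show thesis by (rule that)
qed

lemma cont_seminorms_nonempty:
  assumes "locally_convex_space L T"
  shows "cont_seminorms L T \<noteq> {}"
proof -
  have "\<zero> \<in> topspace T"
    using assms by (auto simp: locally_convex_space_def)
  then obtain q where "q \<in> cont_seminorms L T"
    by (rule seminorm_in_neighbourhood[OF assms openin_topspace])
  then show ?thesis by blast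
qed

end

text \<open>
  By continuity at the origin, \<open>p [x, y] < 1\<close> for \<open>x\<close> and \<open>y\<close> in the unit ball of some continuous
  seminorm \<open>q\<close>.  Rescaling gives \<open>p [x, y] < s * t\<close> for all \<open>s > q x\<close> and \<open>t > q y\<close>; then let \<open>s\<close> and \<open>t\<close>
  decrease to \<open>q x\<close> and \<open>q y\<close>.
\<close>

lemma (in lie_algebra) bracket_bounded_cont_seminorms:
  assumes lcl: "locally_convex_lie_algebra L T"
  shows "bracket_bounded L (cont_seminorms L T)"
  unfolding bracket_bounded_def
proof
  fix p assume "p \<in> cont_seminorms L T"
  then have p: "seminorm_on L p" and cont_p: "continuous_map T euclideanreal p"
    by (auto simp: cont_seminorms_def)
  have lcs: "locally_convex_space L T" and top: "topspace T = carrier L"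
    and cont: "continuous_map (prod_topology T T) T (\<lambda>(x, y). bracket L x y)"
    using lcl by (auto simp: locally_convex_lie_algebra_def locally_convex_space_def)
  define W where "W = {z \<in> topspace (prod_topology T T). (p \<circ> (\<lambda>(x, y). bracket L x y)) z < 1}"
  have open_W: "openin (prod_topology T T) W"
    unfolding W_def using continuous_map_compose[OF cont cont_p]
    by (simp only: continuous_map_upper_lower_semicontinuous_lt)
  have zero_W: "(\<zero>, \<zero>) \<in> W" by (simp add: W_def top bracket_self seminorm_zero[OF p])
  from openin_prod_topology_alt[THEN iffD1, OF open_W, rule_format, OF zero_W]
  obtain U V where UV: "openin T U" "openin T V" "\<zero> \<in> U" "\<zero> \<in> V" "U \<times> V \<subseteq> W"
    by blast
  obtain q where q: "q \<in> cont_seminorms L T"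
    "\<And>x s. x \<in> carrier L \<Longrightarrow> q x < s \<Longrightarrow> 0 < s \<and> inverse s \<odot> x \<in> U \<inter> V"
    by (rule seminorm_in_neighbourhood[OF lcs openin_Int[OF UV(1,2)] IntI[OF UV(3,4)]], rule that)
  have "p (bracket L x y) \<le> q x * q y" if x: "x \<in> carrier L" and y: "y \<in> carrier L" for x y
  proof -
    have "p (bracket L x y) \<le> (q x + e) * (q y + e)" if "0 < e" for e
    proof -
      define s t where "s = q x + e" and "t = q y + e"
      have s: "0 < s" "inverse s \<odot> x \<in> U" and t: "0 < t" "inverse t \<odot> y \<in> V"
        using q(2)[OF x, of s] q(2)[OF y, of t] \<open>0 < e\<close> by (auto simp: s_def t_def)
      have "p (bracket L (inverse s \<odot> x) (inverse t \<odot> y)) < 1"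
        using UV(5) s(2) t(2) by (auto simp: W_def)
      then have "inverse t * (inverse s * p (bracket L x y)) < 1"
        using x y s(1) t(1)
        by (simp add: bracket_smult_left bracket_smult_right bracket_closed seminorm_scale[OF p])
      then have "p (bracket L x y) < s * t"
        using s(1) t(1) by (simp add: field_simps)
      then show ?thesis by (simp add: s_def t_def)
    qed
    then have "eventually (\<lambda>e. p (bracket L x y) \<le> (q x + e) * (q y + e)) (at_right 0)"
      by (auto simp: eventually_at_right_field intro: exI[of _ 1])
    moreover have "((\<lambda>e. (q x + e) * (q y + e)) \<longlongrightarrow> q x * q y) (at_right 0)"
      by (auto intro!: tendsto_eq_intros)
    ultimately show ?thesis
      by (intro tendsto_lowerbound[of _ "q x * q y" "at_right 0"]) auto
  qed
  then show "\<exists>q\<in>cont_seminorms L T. \<forall>x\<in>carrier L. \<forall>y\<in>carrier L. p (bracket L x y) \<le> q x * q y"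
    using q(1) by blast
qed


section \<open>Transfer along tuples\<close>

text \<open>
  The transfer principle speaks about standard valuations only.  To use it for a tuple of nonstandard
  elements, the variables that hold the tuple are quantified first, and instantiated after transfer.
\<close>

primrec all_below :: "nat \<Rightarrow> 'u fm \<Rightarrow> 'u fm" where
  "all_below 0 f = f"
| "all_below (Suc n) f = all_below n (Neg (Exi n (Neg f)))"

lemma sat_all_below:
  "sat I v (all_below n f) \<longleftrightarrow> (\<forall>w. (\<forall>i\<ge>n. w i = v i) \<longrightarrow> sat I w f)"
proof (induction n arbitrary: f)
  case 0
  show ?case by (auto simp: fun_eq_iff)
next
  case (Suc n)
  have "(\<forall>w. (\<forall>i\<ge>n. w i = v i) \<longrightarrow> (\<forall>x. sat I (w(n := x)) f))
      \<longleftrightarrow> (\<forall>w. (\<forall>i\<ge>Suc n. w i = v i) \<longrightarrow> sat I w f)" (is "?l \<longleftrightarrow> ?r")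
  proof (intro iffI allI impI)
    fix w assume l: ?l and w: "\<forall>i\<ge>Suc n. w i = v i"
    have "\<forall>i\<ge>n. (w(n := v n)) i = v i" using w by (auto simp: le_Suc_eq not_less_eq_eq)
    then have "sat I ((w(n := v n))(n := w n)) f" using l by blast
    then show "sat I w f" by simp
  next
    fix w x assume r: ?r and w: "\<forall>i\<ge>n. w i = v i"
    have "\<forall>i\<ge>Suc n. (w(n := x)) i = v i" using w by simp
    then show "sat I (w(n := x)) f" using r by blast
  qed
  then show ?case by (simp add: Suc)
qed

text \<open>
  The variables from \<open>n\<close> on keep the standard value \<open>c\<close>, which can serve as a parameter in the formula.
\<close>

lemma transfer_uniform:
  assumes "transfer_principle E"
    and "\<And>v. \<forall>i\<ge>n. v i = c \<Longrightarrow> sat (\<lambda>R. R) v f"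
    and "\<forall>i\<ge>n. w i = emb E c"
  shows "sat (star E) w f"
proof -
  have "sat (\<lambda>R. R) (\<lambda>_. c) (all_below n f)"
    using assms(2) by (simp add: sat_all_below)
  then have "sat (star E) (emb E \<circ> (\<lambda>_. c)) (all_below n f)"
    using assms(1) by (simp add: transfer_principle_def)
  then show ?thesis using assms(3) by (simp add: sat_all_below)
qed

definition tuple_val :: "'s list \<Rightarrow> 's \<Rightarrow> nat \<Rightarrow> 's" where
  "tuple_val xs d i = (if i < length xs then xs ! i else d)"

lemma map_tuple_val: "map (tuple_val xs d) [0..<length xs] = xs"
  by (rule nth_equalityI) (auto simp: tuple_val_def)

lemma map_tuple_val_append:
  "map (tuple_val (xs @ ys) d) [0..<length xs] = xs"
  "map (tuple_val (xs @ ys) d) [length xs..<length xs + length ys] = ys"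
  by (rule nth_equalityI; auto simp: tuple_val_def nth_append)+

lemma transfer_valid:
  assumes "transfer_principle E" "\<And>v. sat (\<lambda>R. R) v f"
  shows "sat (star E) (tuple_val xs (emb E c)) f"
  using assms by (rule transfer_uniform[where n = "length xs"]) (auto simp: tuple_val_def)

lemma star_Int:
  assumes "transfer_principle E"
  shows "star E (R \<inter> S) = star E R \<inter> star E S"
proof -
  have "xs \<in> star E (R \<inter> S) \<longleftrightarrow> xs \<in> star E R \<and> xs \<in> star E S" for xs
    using transfer_valid[OF assms, of "let ns = [0..<length xs];
        f = Rel (R \<inter> S) ns; g = Conj (Rel R ns) (Rel S ns)
      in Conj (Neg (Conj f (Neg g))) (Neg (Conj g (Neg f)))" xs undefined]
    by (simp add: map_tuple_val Let_def) blast
  then show ?thesis by auto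
qed

lemma star_Compl:
  assumes "transfer_principle E"
  shows "star E (- R) = - star E R"
proof -
  have "xs \<in> star E (- R) \<longleftrightarrow> xs \<notin> star E R" for xs
    using transfer_valid[OF assms, of "let ns = [0..<length xs];
        f = Rel (- R) ns; g = Rel R ns
      in Conj (Neg (Conj f g)) (Neg (Conj (Neg g) (Neg f)))" xs undefined]
    by (simp add: map_tuple_val Let_def) blast
  then show ?thesis by auto
qed

lemma star_mono:
  assumes "transfer_principle E" "R \<subseteq> S"
  shows "star E R \<subseteq> star E S"
  using star_Int[OF assms(1), of R S] assms(2) by (simp add: Int_absorb2 le_iff_inf)

lemma star_UNIV:
  assumes "transfer_principle E"
  shows "star E UNIV = UNIV"
  using star_mono[OF assms, of "- UNIV" UNIV] unfolding star_Compl[OF assms] by blast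


section \<open>The ultrafilter generated by a tuple of nonstandard elements\<close>

text \<open>
  The type of the tuple \<open>xs\<close>: a property of standard tuples holds eventually if its extension holds
  at \<open>xs\<close>.  Over this filter the extension looks like an ultrapower, in which nonstandard elements are
  germs of functions of standard tuples and standard parts are limits.
\<close>

definition germ :: "('u, 's) extension \<Rightarrow> 's list \<Rightarrow> 'u list filter" where
  "germ E xs = Abs_filter (\<lambda>P. xs \<in> star E {v. P v})"

lemma eventually_germ:
  assumes "transfer_principle E"
  shows "eventually P (germ E xs) \<longleftrightarrow> xs \<in> star E {v. P v}"
proof -
  have "is_filter (\<lambda>P. xs \<in> star E {v. P v})"
  proof
    show "xs \<in> star E {v. True}" by (simp add: star_UNIV[OF assms])
    show "xs \<in> star E {v. P v \<and> Q v}"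
      if "xs \<in> star E {v. P v}" "xs \<in> star E {v. Q v}" for P Q
      using that star_Int[OF assms, of "{v. P v}" "{v. Q v}"] by (simp add: Collect_conj_eq)
    show "xs \<in> star E {v. Q v}"
      if "\<forall>v. P v \<longrightarrow> Q v" "xs \<in> star E {v. P v}" for P Q
      using that star_mono[OF assms, of "{v. P v}" "{v. Q v}"] by blast
  qed
  then show ?thesis by (simp add: germ_def eventually_Abs_filter)
qed

lemma eventually_germ_not:
  assumes "transfer_principle E"
  shows "eventually (\<lambda>v. \<not> P v) (germ E xs) \<longleftrightarrow> \<not> eventually P (germ E xs)"
  using star_Compl[OF assms, of "{v. P v}"]
  by (simp add: eventually_germ[OF assms] Collect_neg_eq)

lemma germ_neq_bot:
  assumes "transfer_principle E"
  shows "germ E xs \<noteq> bot"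
  using eventually_germ_not[OF assms, of "\<lambda>_. True" xs] by (auto simp: trivial_limit_def)

text \<open>
  By compactness the values of \<open>f\<close> have a cluster point; along an ultrafilter a cluster point is a
  limit.
\<close>

lemma bounded_germ_convergent:
  fixes f :: "'u list \<Rightarrow> real"
  assumes "transfer_principle E" and "eventually (\<lambda>v. \<bar>f v\<bar> < B) (germ E xs)"
  obtains l where "(f \<longlongrightarrow> l) (germ E xs)"
proof -
  let ?F = "filtermap f (germ E xs)"
  have "eventually (\<lambda>y. y \<in> {-B..B}) ?F"
    using assms(2) by (auto simp: eventually_filtermap elim!: eventually_mono)
  moreover have "?F \<noteq> bot" by (simp add: filtermap_bot_iff germ_neq_bot assms)
  ultimately obtain l where l: "inf (nhds l) ?F \<noteq> bot"
    using compact_filter[of "{-B..B}"] compact_Icc by blast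
  have "(f \<longlongrightarrow> l) (germ E xs)"
    unfolding tendsto_def
  proof (intro allI impI)
    fix S assume S: "open S" "l \<in> S"
    show "eventually (\<lambda>v. f v \<in> S) (germ E xs)"
    proof (rule ccontr)
      assume "\<not> ?thesis"
      then have "eventually (\<lambda>y. y \<notin> S) ?F"
        using eventually_germ_not[OF assms(1), of "\<lambda>v. f v \<in> S"] by (simp add: eventually_filtermap)
      moreover have "eventually (\<lambda>y. y \<in> S) (nhds l)"
        using S by (simp add: eventually_nhds) blast
      ultimately have "eventually (\<lambda>_. False) (inf (nhds l) ?F)"
        by (auto simp: eventually_inf)
      then show False using l by (simp add: trivial_limit_def)
    qed
  qed
  then show thesis by (rule that)
qed

text \<open>
  The element \<open>z\<close> is the value at \<open>xs\<close> of the extension of \<open>F\<close>.  The graph of \<open>F\<close> codes the value as the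
  last entry of a list.
\<close>

definition rep :: "('u, 's) extension \<Rightarrow> 's list \<Rightarrow> 's \<Rightarrow> ('u list \<Rightarrow> 'u) \<Rightarrow> bool" where
  "rep E xs z F \<longleftrightarrow> xs @ [z] \<in> star E {v @ [F v] | v. True}"

lemma sat_foldr_Conj: "sat I v (foldr Conj fs (Eq 0 0)) \<longleftrightarrow> (\<forall>f \<in> set fs. sat I v f)"
  by (induction fs) auto

text \<open>
  The theorem of Los for atomic formulas.  The relation between the graphs of the \<open>Fs\<close>, the relation
  \<open>R\<close> and its preimage under the \<open>Fs\<close> is a universal sentence, which is transferred.
\<close>

lemma star_rep_iff:
  assumes tp: "transfer_principle E" and zs: "list_all2 (rep E xs) zs Fs"
  shows "zs \<in> star E R \<longleftrightarrow> eventually (\<lambda>v. map (\<lambda>F. F v) Fs \<in> R) (germ E xs)"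
proof -
  define n k where "n = length xs" and "k = length zs"
  have len: "length Fs = k" using zs by (simp add: k_def list_all2_lengthD)
  define gs where "gs = map (\<lambda>i. Rel {v @ [(Fs ! i) v] | v. True} ([0..<n] @ [n + i])) [0..<k]"
  define f g where "f = Rel R [n..<n + k]" and "g = Rel {v. map (\<lambda>F. F v) Fs \<in> R} [0..<n]"
  let ?h = "Neg (Conj (foldr Conj gs (Eq 0 0))
    (Neg (Conj (Neg (Conj f (Neg g))) (Neg (Conj g (Neg f))))))"
  let ?w = "tuple_val (xs @ zs) (emb E undefined)"
  have "sat (\<lambda>R. R) v ?h" for v
  proof -
    have "map v [n..<n + k] = map (\<lambda>F. F (map v [0..<n])) Fs"
      if "\<forall>i<k. v (n + i) = (Fs ! i) (map v [0..<n])"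
      using that by (intro nth_equalityI) (auto simp: len)
    then show ?thesis by (auto simp: sat_foldr_Conj gs_def f_def g_def)
  qed
  then have h: "sat (star E) ?w ?h" by (rule transfer_valid[OF tp])
  have m: "map ?w [0..<n] = xs" "map ?w [n..<n + k] = zs"
    by (simp_all add: n_def k_def map_tuple_val_append)
  have "?w (n + i) = zs ! i" if "i < k" for i
    using that by (simp add: tuple_val_def n_def k_def nth_append)
  then have "sat (star E) ?w (foldr Conj gs (Eq 0 0))"
    using zs m(1) by (auto simp: sat_foldr_Conj gs_def list_all2_conv_all_nth k_def rep_def)
  with h have "zs \<in> star E R \<longleftrightarrow> xs \<in> star E {v. map (\<lambda>F. F v) Fs \<in> R}"
    by (auto simp: f_def g_def m)
  then show ?thesis by (simp add: eventually_germ[OF tp])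
qed

lemma rep_exists:
  assumes tp: "transfer_principle E"
  obtains z where "rep E xs z F"
proof -
  let ?n = "length xs"
  have "sat (star E) (tuple_val xs (emb E undefined))
          (Exi ?n (Rel {v @ [F v] | v. True} ([0..<?n] @ [?n])))"
    by (rule transfer_valid[OF tp]) auto
  moreover have "map ((tuple_val xs d)(?n := z)) [0..<?n] = xs" for d z
    by (rule nth_equalityI) (auto simp: tuple_val_def)
  ultimately show thesis using that by (auto simp: rep_def simp del: map_eq_conv)
qed

lemma rep_proj:
  assumes tp: "transfer_principle E" and i: "i < length xs"
  shows "rep E xs (xs ! i) (\<lambda>v. v ! i)"
proof -
  let ?n = "length xs"
  have "sat (star E) (tuple_val xs (emb E undefined))
          (Rel {v @ [v ! i] | v. True} ([0..<?n] @ [i]))"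
    using i by (intro transfer_valid[OF tp]) auto
  then show ?thesis using i by (simp add: rep_def map_tuple_val) (simp add: tuple_val_def)
qed

lemma rep_emb:
  assumes tp: "transfer_principle E"
  shows "rep E xs (emb E c) (\<lambda>_. c)"
proof -
  let ?n = "length xs"
  have "sat (star E) (tuple_val xs (emb E c))
          (Rel {v @ [c] | v. True} ([0..<?n] @ [?n]))"
    by (rule transfer_uniform[OF tp, where n = ?n and c = c]) (auto simp: tuple_val_def)
  then show ?thesis by (simp add: rep_def map_tuple_val) (simp add: tuple_val_def)
qed

lemma star_diagonal:
  assumes tp: "transfer_principle E"
  shows "[x, y] \<in> star E (range (\<lambda>a. [a, a])) \<longleftrightarrow> x = y"
  using transfer_valid[OF tp, of "Conj (Neg (Conj (Rel (range (\<lambda>a. [a, a])) [0, 1]) (Neg (Eq 0 1))))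
      (Neg (Conj (Eq 0 1) (Neg (Rel (range (\<lambda>a. [a, a])) [0, 1]))))" "[x, y]" undefined]
  by (simp add: tuple_val_def image_iff) blast

lemma rep_eq_iff:
  assumes "transfer_principle E" "rep E xs y F" "rep E xs z G"
  shows "y = z \<longleftrightarrow> eventually (\<lambda>v. F v = G v) (germ E xs)"
proof -
  have "[a, b] \<in> range (\<lambda>a. [a, a]) \<longleftrightarrow> a = b" for a b :: 'a by auto
  then show ?thesis
    using star_rep_iff[OF assms(1), of xs "[y, z]" "[F, G]" "range (\<lambda>a. [a, a])"] assms
    by (simp add: star_diagonal)
qed

lemma rep_cong:
  assumes "transfer_principle E" "rep E xs z F" "eventually (\<lambda>v. F v = G v) (germ E xs)"
  shows "rep E xs z G"
  by (metis assms rep_eq_iff rep_exists)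

text \<open>
  If \<open>R\<close> sends the values of the \<open>Fs\<close> to the values of \<open>h\<close>, then the extension of \<open>R\<close> sends \<open>ys\<close> to the
  element represented by \<open>h\<close>; uniqueness of the value transfers from \<open>R\<close> to its extension.
\<close>

lemma rep_star_app:
  assumes tp: "transfer_principle E" and ys: "list_all2 (rep E xs) ys Fs"
    and graph: "eventually (\<lambda>v. map (\<lambda>F. F v) Fs @ [h v] \<in> R) (germ E xs)"
    and functional: "\<And>u a b. u @ [a] \<in> R \<Longrightarrow> u @ [b] \<in> R \<Longrightarrow> a = b"
  shows "rep E xs (star_app E R ys) h"
proof -
  obtain z where z: "rep E xs z h" using rep_exists[OF tp] .
  have zR: "ys @ [z] \<in> star E R"
    using star_rep_iff[OF tp, of xs "ys @ [z]" "Fs @ [h]" R] ys z graph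
    by (simp add: list_all2_appendI)
  have "y = z" if y: "ys @ [y] \<in> star E R" for y
  proof -
    let ?k = "length ys"
    let ?f = "Conj (Rel R ([0..<?k] @ [?k])) (Rel R ([0..<?k] @ [Suc ?k]))"
    have "sat (star E) (tuple_val (ys @ [y, z]) (emb E undefined))
        (Neg (Conj ?f (Neg (Eq ?k (Suc ?k)))))"
      by (rule transfer_valid[OF tp]) (auto dest: functional)
    then show ?thesis using y zR
      by (simp add: map_tuple_val_append del: upt_Suc) (simp add: tuple_val_def nth_append)
  qed
  then have "star_app E R ys = z"
    unfolding star_app_def using zR by blast
  then show ?thesis using z by simp
qed


section \<open>Hyperreals as germs of real functions\<close>

definition nrep :: "('g, 's) lie_extension \<Rightarrow> 's list \<Rightarrow> 's \<Rightarrow> (('g + real) univ list \<Rightarrow> real) \<Rightarrow> bool" where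
  "nrep E xs z f \<longleftrightarrow> rep E xs z (\<lambda>v. num (f v))"

definition vrep :: "('g, 's) lie_extension \<Rightarrow> 'g lie \<Rightarrow> 's list \<Rightarrow> 's
    \<Rightarrow> (('g + real) univ list \<Rightarrow> 'g) \<Rightarrow> bool" where
  "vrep E L xs z a \<longleftrightarrow> rep E xs z (\<lambda>v. vec (a v)) \<and> eventually (\<lambda>v. a v \<in> carrier L) (germ E xs)"

context
  fixes E :: "('g, 's) lie_extension"
  assumes tp: "transfer_principle E"
begin

lemma nrep_emb: "nrep E xs (emb E (num c)) (\<lambda>_. c)"
  unfolding nrep_def by (rule rep_emb[OF tp])

lemma nrep_star_set: "nrep E xs z f \<Longrightarrow> z \<in> star_set E (range num)"
  using star_rep_iff[OF tp, of xs "[z]" "[\<lambda>v. num (f v)]" "(\<lambda>a. [a]) ` range num"]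
  by (auto simp: star_set_def nrep_def)

lemma nrep_habs:
  assumes "nrep E xs z f" shows "nrep E xs (habs E z) (\<lambda>v. \<bar>f v\<bar>)"
  unfolding nrep_def habs_def
  by (rule rep_star_app[OF tp, of xs "[z]" "[\<lambda>v. num (f v)]"])
    (use assms in \<open>auto simp: nrep_def append_eq_Cons_conv\<close>)

lemma nrep_hminus:
  assumes "nrep E xs z f" "nrep E xs w g" shows "nrep E xs (hminus E z w) (\<lambda>v. f v - g v)"
  unfolding nrep_def hminus_def
  by (rule rep_star_app[OF tp, of xs "[z, w]" "[\<lambda>v. num (f v), \<lambda>v. num (g v)]"])
    (use assms in \<open>auto simp: nrep_def append_eq_Cons_conv\<close>)

lemma hless_iff:
  assumes "nrep E xs z f" "nrep E xs w g"
  shows "hless E z w \<longleftrightarrow> eventually (\<lambda>v. f v < g v) (germ E xs)"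
  using star_rep_iff[OF tp, of xs "[z, w]" "[\<lambda>v. num (f v), \<lambda>v. num (g v)]"
      "{[num r, num s] | r s. r < s}"] assms
  by (simp add: hless_def nrep_def)

lemma hinfinitesimal_iff:
  assumes "nrep E xs z f"
  shows "hinfinitesimal E z \<longleftrightarrow> (f \<longlongrightarrow> 0) (germ E xs)"
  using hless_iff[OF nrep_habs[OF assms] nrep_emb] nrep_star_set[OF assms]
  by (simp add: hinfinitesimal_def tendsto_iff)

lemma st_eq:
  assumes "nrep E xs z f" "(f \<longlongrightarrow> l) (germ E xs)"
  shows "st E z = l"
proof -
  have "hinfinitesimal E (hminus E z (emb E (num r))) \<longleftrightarrow> r = l" for r
    using hinfinitesimal_iff[OF nrep_hminus[OF assms(1) nrep_emb], of r]
      tendsto_unique[OF germ_neq_bot[OF tp] assms(2), of r] assms(2)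
    by (auto simp: LIM_zero_iff)
  then show ?thesis by (simp add: st_def)
qed

lemma hfinite_tendsto_st:
  assumes "nrep E xs z f" "hfinite E z"
  shows "(f \<longlongrightarrow> st E z) (germ E xs)"
proof -
  obtain r where "eventually (\<lambda>v. \<bar>f v\<bar> < r) (germ E xs)"
    using assms hless_iff[OF nrep_habs[OF assms(1)] nrep_emb] by (auto simp: hfinite_def)
  then obtain l where "(f \<longlongrightarrow> l) (germ E xs)" by (rule bounded_germ_convergent[OF tp])
  then show ?thesis using st_eq[OF assms(1)] by simp
qed

lemma hfiniteI:
  assumes "nrep E xs z f" "eventually (\<lambda>v. \<bar>f v\<bar> \<le> g v) (germ E xs)" "(g \<longlongrightarrow> l) (germ E xs)"
  shows "hfinite E z"
proof -
  have "eventually (\<lambda>v. g v < l + 1) (germ E xs)"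
    using assms(3) by (rule order_tendstoD) simp
  with assms(2) have "eventually (\<lambda>v. \<bar>f v\<bar> < l + 1) (germ E xs)"
    by eventually_elim simp
  then show ?thesis
    using hless_iff[OF nrep_habs[OF assms(1)] nrep_emb] nrep_star_set[OF assms(1)]
    by (auto simp: hfinite_def)
qed


section \<open>Nonstandard vectors as germs of vector-valued functions\<close>

text \<open>
  A member of the tuple is represented by the coordinate function; as the member lies in the
  extension of the vector space, almost all values of this function are vectors.
\<close>

lemma vrepI:
  fixes L :: "'g lie"
  assumes "z \<in> set xs" "z \<in> star_set E (vec ` carrier L)"
  obtains a where "vrep E L xs z a"
proof -
  obtain i where i: "i < length xs" "xs ! i = z" using assms(1) by (auto simp: in_set_conv_nth)
  define a where "a = (\<lambda>v. the_inv (vec :: 'g \<Rightarrow> ('g + real) univ) (v ! i))"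
  have r: "rep E xs z (\<lambda>v. v ! i)" using rep_proj[OF tp i(1)] i(2) by simp
  have inj: "inj (vec :: 'g \<Rightarrow> ('g + real) univ)" by (auto simp: inj_def)
  have "eventually (\<lambda>v. v ! i \<in> vec ` carrier L) (germ E xs)"
    using star_rep_iff[OF tp, of xs "[z]" "[\<lambda>v. v ! i]" "(\<lambda>a. [a]) ` vec ` carrier L"] r assms(2)
    by (simp add: star_set_def image_iff)
  then have ev: "eventually (\<lambda>v. v ! i = vec (a v) \<and> a v \<in> carrier L) (germ E xs)"
    by (rule eventually_mono) (auto simp: a_def the_inv_f_f[OF inj])
  then have "vrep E L xs z a"
    using rep_cong[OF tp r, of "\<lambda>v. vec (a v)"] by (simp add: vrep_def eventually_conj_iff)
  then show thesis by (rule that)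
qed

lemma vrep_eqI:
  assumes "vrep E L xs y a" "vrep E L xs z b" "eventually (\<lambda>v. a v = b v) (germ E xs)"
  shows "y = z"
  using rep_eq_iff[OF tp, of xs y _ z] assms by (auto simp: vrep_def elim: eventually_mono)

lemma nrep_star_seminorm:
  assumes "vrep E L xs z a"
  shows "nrep E xs (star_seminorm E L p z) (\<lambda>v. p (a v))"
  unfolding nrep_def star_seminorm_def
  by (rule rep_star_app[OF tp, of xs "[z]" "[\<lambda>v. vec (a v)]"])
    (use assms in \<open>auto simp: vrep_def append_eq_Cons_conv\<close>)

end

context lie_algebra
begin

context
  fixes E :: "('a, 's) lie_extension"
  assumes tp: "transfer_principle E"
begin

lemma vrep_zero: "vrep E L xs (emb E (vec \<zero>)) (\<lambda>_. \<zero>)"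
  by (simp add: vrep_def rep_emb[OF tp])

lemma vrep_star_add:
  assumes "vrep E L xs x a" "vrep E L xs y b"
  shows "vrep E L xs (star_add E L x y) (\<lambda>v. a v \<oplus> b v)"
proof -
  have c: "eventually (\<lambda>v. a v \<in> carrier L \<and> b v \<in> carrier L) (germ E xs)"
    using assms by (simp add: vrep_def eventually_conj)
  have "rep E xs (star_add E L x y) (\<lambda>v. vec (a v \<oplus> b v))"
    unfolding star_add_def
    by (rule rep_star_app[OF tp, of xs "[x, y]" "[\<lambda>v. vec (a v), \<lambda>v. vec (b v)]"])
      (use assms in \<open>auto simp: vrep_def append_eq_Cons_conv intro!: eventually_mono[OF c]\<close>)
  then show ?thesis using c by (auto simp: vrep_def elim!: eventually_mono)
qed

lemma vrep_star_smult:
  assumes "vrep E L xs x a"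
  shows "vrep E L xs (star_smult E L (emb E (num c)) x) (\<lambda>v. c \<odot> a v)"
proof -
  have a: "eventually (\<lambda>v. a v \<in> carrier L) (germ E xs)"
    using assms by (simp add: vrep_def)
  have "rep E xs (star_smult E L (emb E (num c)) x) (\<lambda>v. vec (c \<odot> a v))"
    unfolding star_smult_def
    by (rule rep_star_app[OF tp, of xs "[emb E (num c), x]" "[\<lambda>_. num c, \<lambda>v. vec (a v)]"])
      (use assms rep_emb[OF tp] in \<open>auto simp: vrep_def append_eq_Cons_conv intro!: eventually_mono[OF a]\<close>)
  then show ?thesis using a by (auto simp: vrep_def elim!: eventually_mono)
qed

lemma vrep_star_bracket:
  assumes "vrep E L xs x a" "vrep E L xs y b"
  shows "vrep E L xs (star_bracket E L x y) (\<lambda>v. bracket L (a v) (b v))"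
proof -
  have c: "eventually (\<lambda>v. a v \<in> carrier L \<and> b v \<in> carrier L) (germ E xs)"
    using assms by (simp add: vrep_def eventually_conj)
  have "rep E xs (star_bracket E L x y) (\<lambda>v. vec (bracket L (a v) (b v)))"
    unfolding star_bracket_def
    by (rule rep_star_app[OF tp, of xs "[x, y]" "[\<lambda>v. vec (a v), \<lambda>v. vec (b v)]"])
      (use assms in \<open>auto simp: vrep_def append_eq_Cons_conv intro!: eventually_mono[OF c]\<close>)
  then show ?thesis using c by (auto simp: vrep_def bracket_closed elim!: eventually_mono)
qed

end

end


section \<open>The Lie algebra of finite elements\<close>

definition finite_lie ::
    "('g, 's) lie_extension \<Rightarrow> 'g lie \<Rightarrow> 'g topology \<Rightarrow> 's set \<Rightarrow> 's lie" where
  "finite_lie E L T H =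
     \<lparr>carrier = fin_part E L T H, mult = undefined, one = undefined,
      zero = emb E (vec \<zero>\<^bsub>L\<^esub>), add = star_add E L,
      smult = (\<lambda>c. star_smult E L (emb E (num c))), bracket = star_bracket E L\<rparr>"

definition st_seminorm :: "('g, 's) lie_extension \<Rightarrow> 'g lie \<Rightarrow> ('g \<Rightarrow> real) \<Rightarrow> 's \<Rightarrow> real" where
  "st_seminorm E L p x = st E (star_seminorm E L p x)"

locale internal_subalgebra = lie_algebra L for L :: "'g lie" (structure) +
  fixes T :: "'g topology" and E :: "('g, 's) lie_extension" and H :: "'s set"
  assumes tp: "transfer_principle E"
    and lcl: "locally_convex_lie_algebra L T"
    and subalgebra: "internal_lie_subalgebra E L H"
begin

abbreviation \<Gamma> where "\<Gamma> \<equiv> cont_seminorms L T"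
abbreviation A where "A \<equiv> finite_lie E L T H"
abbreviation I where "I \<equiv> inf_part E L T H"

lemma cont_seminorm: "p \<in> \<Gamma> \<Longrightarrow> seminorm_on L p"
  by (simp add: cont_seminorms_def)

lemma vrep_subalgebra:
  assumes "z \<in> H" "z \<in> set xs"
  obtains a where "vrep E L xs z a"
  using vrepI[OF tp, of z xs L] assms subalgebra by (auto simp: internal_lie_subalgebra_def)

text \<open>
  A bound by a convergent function makes the values of each seminorm finite.
\<close>

lemma fin_partI:
  assumes z: "z \<in> H" "vrep E L xs z a"
    and bound: "\<And>p. p \<in> \<Gamma> \<Longrightarrow>
      \<exists>g l. eventually (\<lambda>v. p (a v) \<le> g v) (germ E xs) \<and> (g \<longlongrightarrow> l) (germ E xs)"
  shows "z \<in> fin_part E L T H"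
proof -
  have "hfinite E (star_seminorm E L p z)" if p: "p \<in> \<Gamma>" for p
  proof -
    obtain g l where g: "eventually (\<lambda>v. p (a v) \<le> g v) (germ E xs)" "(g \<longlongrightarrow> l) (germ E xs)"
      using bound[OF p] by blast
    have "eventually (\<lambda>v. a v \<in> carrier L) (germ E xs)" using z(2) by (simp add: vrep_def)
    with g(1) have "eventually (\<lambda>v. \<bar>p (a v)\<bar> \<le> g v) (germ E xs)"
      by eventually_elim (simp add: seminorm_nonneg[OF cont_seminorm[OF p]])
    then show ?thesis using g(2) by (rule hfiniteI[OF tp nrep_star_seminorm[OF tp z(2)]])
  qed
  then show ?thesis using z(1) by (simp add: fin_part_def)
qed

lemma tendsto_st_seminorm:
  assumes "z \<in> fin_part E L T H" "vrep E L xs z a" "p \<in> \<Gamma>"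
  shows "((\<lambda>v. p (a v)) \<longlongrightarrow> st_seminorm E L p z) (germ E xs)"
  unfolding st_seminorm_def
  using hfinite_tendsto_st[OF tp nrep_star_seminorm[OF tp assms(2)]] assms(1,3)
  by (simp add: fin_part_def)

lemma st_seminorm_eq:
  assumes "vrep E L xs z a" "((\<lambda>v. p (a v)) \<longlongrightarrow> l) (germ E xs)"
  shows "st_seminorm E L p z = l"
  unfolding st_seminorm_def
  using st_eq[OF tp nrep_star_seminorm[OF tp assms(1)]] assms(2) .

text \<open>
  Elements are represented over a common tuple, so that equations and inequalities between them can
  be checked pointwise.
\<close>

lemma common_representatives:
  assumes "x \<in> fin_part E L T H" "y \<in> fin_part E L T H" "z \<in> fin_part E L T H"
  obtains xs a b c where "vrep E L xs x a" "vrep E L xs y b" "vrep E L xs z c"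
    "eventually (\<lambda>v. a v \<in> carrier L \<and> b v \<in> carrier L \<and> c v \<in> carrier L) (germ E xs)"
proof -
  have H: "x \<in> H" "y \<in> H" "z \<in> H" using assms by (auto simp: fin_part_def)
  obtain a where a: "vrep E L [x, y, z] x a" using vrep_subalgebra[OF H(1), of "[x, y, z]"] by auto
  obtain b where b: "vrep E L [x, y, z] y b" using vrep_subalgebra[OF H(2), of "[x, y, z]"] by auto
  obtain c where c: "vrep E L [x, y, z] z c" using vrep_subalgebra[OF H(3), of "[x, y, z]"] by auto
  show thesis using a b c by (intro that[OF a b c]) (simp add: vrep_def eventually_conj_iff)
qed

lemma subalgebra_closed:
  "emb E (vec \<zero>) \<in> H"
  "x \<in> H \<Longrightarrow> y \<in> H \<Longrightarrow> star_add E L x y \<in> H"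
  "x \<in> H \<Longrightarrow> star_smult E L (emb E (num c)) x \<in> H"
  "x \<in> H \<Longrightarrow> y \<in> H \<Longrightarrow> star_bracket E L x y \<in> H"
  using subalgebra nrep_star_set[OF tp nrep_emb[OF tp, of "[]" c]]
  by (auto simp: internal_lie_subalgebra_def)

lemma fin_zero: "emb E (vec \<zero>) \<in> fin_part E L T H"
  by (rule fin_partI[OF subalgebra_closed(1) vrep_zero[OF tp, of "[]"]])
    (intro exI conjI, rule eventually_mono[OF eventually_True], rule order_refl, rule tendsto_const)

lemma fin_add:
  assumes x: "x \<in> fin_part E L T H" and y: "y \<in> fin_part E L T H"
  shows "star_add E L x y \<in> fin_part E L T H"
proof -
  obtain xs a b where a: "vrep E L xs x a" and b: "vrep E L xs y b"
    and ev: "eventually (\<lambda>v. a v \<in> carrier L \<and> b v \<in> carrier L) (germ E xs)"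
    by (rule common_representatives[OF x y y]) (auto simp: eventually_conj_iff)
  show ?thesis
  proof (rule fin_partI[OF _ vrep_star_add[OF tp a b]])
    fix p assume p: "p \<in> \<Gamma>"
    have "eventually (\<lambda>v. p (a v \<oplus> b v) \<le> p (a v) + p (b v)) (germ E xs)"
      using ev by eventually_elim (simp add: seminorm_triangle[OF cont_seminorm[OF p]])
    then show "\<exists>g l. eventually (\<lambda>v. p (a v \<oplus> b v) \<le> g v) (germ E xs) \<and> (g \<longlongrightarrow> l) (germ E xs)"
      using tendsto_add[OF tendsto_st_seminorm[OF x a p] tendsto_st_seminorm[OF y b p]]
      by (intro exI conjI)
  qed (use x y subalgebra_closed in \<open>simp add: fin_part_def\<close>)
qed

lemma fin_smult:
  assumes x: "x \<in> fin_part E L T H"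
  shows "star_smult E L (emb E (num c)) x \<in> fin_part E L T H"
proof -
  obtain xs a where a: "vrep E L xs x a"
    and ev: "eventually (\<lambda>v. a v \<in> carrier L) (germ E xs)"
    by (rule common_representatives[OF x x x]) (auto simp: eventually_conj_iff)
  show ?thesis
  proof (rule fin_partI[OF _ vrep_star_smult[OF tp a]])
    fix p assume p: "p \<in> \<Gamma>"
    have "eventually (\<lambda>v. p (c \<odot> a v) \<le> \<bar>c\<bar> * p (a v)) (germ E xs)"
      using ev by eventually_elim (simp add: seminorm_scale[OF cont_seminorm[OF p]])
    then show "\<exists>g l. eventually (\<lambda>v. p (c \<odot> a v) \<le> g v) (germ E xs) \<and> (g \<longlongrightarrow> l) (germ E xs)"
      using tendsto_mult_left[OF tendsto_st_seminorm[OF x a p]] by (intro exI conjI)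
  qed (use x subalgebra_closed in \<open>simp add: fin_part_def\<close>)
qed

lemma fin_bracket:
  assumes x: "x \<in> fin_part E L T H" and y: "y \<in> fin_part E L T H"
  shows "star_bracket E L x y \<in> fin_part E L T H"
proof -
  obtain xs a b where a: "vrep E L xs x a" and b: "vrep E L xs y b"
    and ev: "eventually (\<lambda>v. a v \<in> carrier L \<and> b v \<in> carrier L) (germ E xs)"
    by (rule common_representatives[OF x y y]) (auto simp: eventually_conj_iff)
  show ?thesis
  proof (rule fin_partI[OF _ vrep_star_bracket[OF tp a b]])
    fix p assume p: "p \<in> \<Gamma>"
    obtain q where q: "q \<in> \<Gamma>"
      "\<And>x y. x \<in> carrier L \<Longrightarrow> y \<in> carrier L \<Longrightarrow> p (bracket L x y) \<le> q x * q y"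
      using bracket_boundedE[OF bracket_bounded_cont_seminorms[OF lcl] p] by metis
    have "eventually (\<lambda>v. p (bracket L (a v) (b v)) \<le> q (a v) * q (b v)) (germ E xs)"
      using ev by eventually_elim (simp add: q(2))
    then show "\<exists>g l. eventually (\<lambda>v. p (bracket L (a v) (b v)) \<le> g v) (germ E xs) \<and>
        (g \<longlongrightarrow> l) (germ E xs)"
      using tendsto_mult[OF tendsto_st_seminorm[OF x a q(1)] tendsto_st_seminorm[OF y b q(1)]]
      by (intro exI conjI)
  qed (use x y subalgebra_closed in \<open>simp add: fin_part_def\<close>)
qed

lemma finite_lie_simps:
  "carrier A = fin_part E L T H" "zero A = emb E (vec \<zero>)" "add A = star_add E L"
  "smult A = (\<lambda>c. star_smult E L (emb E (num c)))" "bracket A = star_bracket E L"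
  by (simp_all add: finite_lie_def)

lemmas vrep_ops = vrep_star_add[OF tp] vrep_star_smult[OF tp] vrep_star_bracket[OF tp] vrep_zero[OF tp]

text \<open>
  The elements of the extension obey the laws of \<open>L\<close>, because these hold pointwise for representing
  functions.  No product with a hyperreal occurs: only standard scalars act.
\<close>

lemma lie_algebra_finite: "lie_algebra A"
proof -
  have abelian: "abelian_group A"
  proof (rule abelian_groupI)
    fix x y z assume "x \<in> carrier A" "y \<in> carrier A" "z \<in> carrier A"
    then have xyz: "x \<in> fin_part E L T H" "y \<in> fin_part E L T H" "z \<in> fin_part E L T H"
      by (simp_all add: finite_lie_simps)
    obtain xs a b c where reps: "vrep E L xs x a" "vrep E L xs y b" "vrep E L xs z c"
      and ev: "eventually (\<lambda>v. a v \<in> carrier L \<and> b v \<in> carrier L \<and> c v \<in> carrier L) (germ E xs)"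
      using xyz by (rule common_representatives)
    note eqI = vrep_eqI[OF tp, where xs = xs and L = L]
    show "x \<oplus>\<^bsub>A\<^esub> y \<oplus>\<^bsub>A\<^esub> z = x \<oplus>\<^bsub>A\<^esub> (y \<oplus>\<^bsub>A\<^esub> z)" "x \<oplus>\<^bsub>A\<^esub> y = y \<oplus>\<^bsub>A\<^esub> x" "\<zero>\<^bsub>A\<^esub> \<oplus>\<^bsub>A\<^esub> x = x"
      unfolding finite_lie_simps
      by (rule eqI, (rule vrep_ops reps)+, rule eventually_mono[OF ev], simp add: M.a_ac)+
    have "star_add E L (star_smult E L (emb E (num (- 1))) x) x = emb E (vec \<zero>)"
      by (rule eqI, (rule vrep_ops reps)+, rule eventually_mono[OF ev])
        (simp add: scale_minus_one M.l_neg)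
    then show "\<exists>w\<in>carrier A. w \<oplus>\<^bsub>A\<^esub> x = \<zero>\<^bsub>A\<^esub>"
      using fin_smult[OF xyz(1)] by (auto simp: finite_lie_simps)
  qed (auto simp: finite_lie_simps fin_add fin_zero)
  have module: "Module.module real_ring A"
  proof (rule moduleI[OF cring_real_ring abelian])
    fix d e x y assume "x \<in> carrier A" "y \<in> carrier A"
    then have xy: "x \<in> fin_part E L T H" "y \<in> fin_part E L T H" "y \<in> fin_part E L T H"
      by (simp_all add: finite_lie_simps)
    obtain xs a b c where reps: "vrep E L xs x a" "vrep E L xs y b" "vrep E L xs y c"
      and ev: "eventually (\<lambda>v. a v \<in> carrier L \<and> b v \<in> carrier L \<and> c v \<in> carrier L) (germ E xs)"
      using xy by (rule common_representatives)
    note eqI = vrep_eqI[OF tp, where xs = xs and L = L]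
    show "d \<odot>\<^bsub>A\<^esub> (x \<oplus>\<^bsub>A\<^esub> y) = d \<odot>\<^bsub>A\<^esub> x \<oplus>\<^bsub>A\<^esub> d \<odot>\<^bsub>A\<^esub> y"
      unfolding finite_lie_simps
      by (rule eqI, (rule vrep_ops reps)+, rule eventually_mono[OF ev], simp add: scale_add_right)
    show "(d \<oplus>\<^bsub>real_ring\<^esub> e) \<odot>\<^bsub>A\<^esub> x = d \<odot>\<^bsub>A\<^esub> x \<oplus>\<^bsub>A\<^esub> e \<odot>\<^bsub>A\<^esub> x"
      unfolding finite_lie_simps
      by (rule eqI, (rule vrep_ops reps)+, rule eventually_mono[OF ev], simp add: scale_add_left)
    show "(d \<otimes>\<^bsub>real_ring\<^esub> e) \<odot>\<^bsub>A\<^esub> x = d \<odot>\<^bsub>A\<^esub> (e \<odot>\<^bsub>A\<^esub> x)"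
      unfolding finite_lie_simps
      by (rule eqI, (rule vrep_ops reps)+, rule eventually_mono[OF ev], simp add: scale_scale)
    show "\<one>\<^bsub>real_ring\<^esub> \<odot>\<^bsub>A\<^esub> x = x"
      unfolding finite_lie_simps
      by (rule eqI, (rule vrep_ops reps)+, rule eventually_mono[OF ev], simp)
  qed (simp add: finite_lie_simps fin_smult)
  show ?thesis
  proof (intro lie_algebra.intro lie_algebra_axioms.intro module)
    fix x y z and d :: real assume "x \<in> carrier A" "y \<in> carrier A" "z \<in> carrier A"
    then have xyz: "x \<in> fin_part E L T H" "y \<in> fin_part E L T H" "z \<in> fin_part E L T H"
      by (simp_all add: finite_lie_simps)
    obtain xs a b c where reps: "vrep E L xs x a" "vrep E L xs y b" "vrep E L xs z c"
      and ev: "eventually (\<lambda>v. a v \<in> carrier L \<and> b v \<in> carrier L \<and> c v \<in> carrier L) (germ E xs)"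
      using xyz by (rule common_representatives)
    note eqI = vrep_eqI[OF tp, where xs = xs and L = L]
    show "bracket A (x \<oplus>\<^bsub>A\<^esub> y) z = bracket A x z \<oplus>\<^bsub>A\<^esub> bracket A y z"
      and "bracket A x (y \<oplus>\<^bsub>A\<^esub> z) = bracket A x y \<oplus>\<^bsub>A\<^esub> bracket A x z"
      and "bracket A (d \<odot>\<^bsub>A\<^esub> x) y = d \<odot>\<^bsub>A\<^esub> bracket A x y"
      and "bracket A x (d \<odot>\<^bsub>A\<^esub> y) = d \<odot>\<^bsub>A\<^esub> bracket A x y"
      and "bracket A x x = \<zero>\<^bsub>A\<^esub>"
      and "bracket A x (bracket A y z) \<oplus>\<^bsub>A\<^esub> bracket A y (bracket A z x)
              \<oplus>\<^bsub>A\<^esub> bracket A z (bracket A x y) = \<zero>\<^bsub>A\<^esub>"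
      unfolding finite_lie_simps
      by (rule eqI, (rule vrep_ops reps)+, rule eventually_mono[OF ev],
        simp add: bracket_add_left bracket_add_right bracket_smult_left bracket_smult_right
          bracket_self jacobi)+
  qed (simp add: finite_lie_simps fin_bracket)
qed

lemma seminorm_st_seminorm:
  assumes p: "p \<in> \<Gamma>"
  shows "seminorm_on A (st_seminorm E L p)"
  unfolding seminorm_on_def finite_lie_simps
proof (intro conjI ballI allI)
  fix x y and d :: real assume x: "x \<in> fin_part E L T H" and y: "y \<in> fin_part E L T H"
  obtain xs a b where a: "vrep E L xs x a" and b: "vrep E L xs y b"
    and ev: "eventually (\<lambda>v. a v \<in> carrier L \<and> b v \<in> carrier L) (germ E xs)"
    by (rule common_representatives[OF x y y]) (auto simp: eventually_conj_iff)
  note lim_x = tendsto_st_seminorm[OF x a p] and lim_y = tendsto_st_seminorm[OF y b p]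
  note nonbot = germ_neq_bot[OF tp]
  have "eventually (\<lambda>v. 0 \<le> p (a v)) (germ E xs)"
    using ev by eventually_elim (simp add: seminorm_nonneg[OF cont_seminorm[OF p]])
  then show "0 \<le> st_seminorm E L p x"
    by (rule tendsto_lowerbound[OF lim_x _ nonbot])
  have "((\<lambda>v. p (d \<odot> a v)) \<longlongrightarrow> \<bar>d\<bar> * st_seminorm E L p x) (germ E xs)"
  proof (rule Lim_transform_eventually[OF tendsto_mult_left[OF lim_x]])
    show "eventually (\<lambda>v. \<bar>d\<bar> * p (a v) = p (d \<odot> a v)) (germ E xs)"
      using ev by eventually_elim (simp add: seminorm_scale[OF cont_seminorm[OF p]])
  qed
  then show "st_seminorm E L p (star_smult E L (emb E (num d)) x) = \<bar>d\<bar> * st_seminorm E L p x"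
    by (rule st_seminorm_eq[OF vrep_star_smult[OF tp a]])
  have "eventually (\<lambda>v. p (a v \<oplus> b v) \<le> p (a v) + p (b v)) (germ E xs)"
    using ev by eventually_elim (simp add: seminorm_triangle[OF cont_seminorm[OF p]])
  then show "st_seminorm E L p (star_add E L x y) \<le> st_seminorm E L p x + st_seminorm E L p y"
    by (rule tendsto_le[OF nonbot tendsto_add[OF lim_x lim_y]
          tendsto_st_seminorm[OF fin_add[OF x y] vrep_star_add[OF tp a b] p]])
qed

text \<open>
  The bound for the bracket on \<open>L\<close> passes to standard parts, as these are limits.
\<close>

lemma st_seminorm_bracket_le:
  assumes p: "p \<in> \<Gamma>" and q: "q \<in> \<Gamma>"
    and bound: "\<And>x y. x \<in> carrier L \<Longrightarrow> y \<in> carrier L \<Longrightarrow> p (bracket L x y) \<le> q x * q y"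
    and x: "x \<in> fin_part E L T H" and y: "y \<in> fin_part E L T H"
  shows "st_seminorm E L p (star_bracket E L x y) \<le> st_seminorm E L q x * st_seminorm E L q y"
proof -
  obtain xs a b where a: "vrep E L xs x a" and b: "vrep E L xs y b"
    and ev: "eventually (\<lambda>v. a v \<in> carrier L \<and> b v \<in> carrier L) (germ E xs)"
    by (rule common_representatives[OF x y y]) (auto simp: eventually_conj_iff)
  have "eventually (\<lambda>v. p (bracket L (a v) (b v)) \<le> q (a v) * q (b v)) (germ E xs)"
    using ev by eventually_elim (simp add: bound)
  then show ?thesis
    by (rule tendsto_le[OF germ_neq_bot[OF tp]
          tendsto_mult[OF tendsto_st_seminorm[OF x a q] tendsto_st_seminorm[OF y b q]]
          tendsto_st_seminorm[OF fin_bracket[OF x y] vrep_star_bracket[OF tp a b] p]])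
qed

lemma seminormed_lie_algebra_finite: "seminormed_lie_algebra A (st_seminorm E L ` \<Gamma>)"
proof -
  interpret A: lie_algebra A by (rule lie_algebra_finite)
  show ?thesis
  proof
    show "seminorm_on A p" if "p \<in> st_seminorm E L ` \<Gamma>" for p
      using that seminorm_st_seminorm by blast
    show "bracket_bounded A (st_seminorm E L ` \<Gamma>)"
      unfolding bracket_bounded_def finite_lie_simps
    proof clarify
      fix p assume p: "p \<in> \<Gamma>"
      obtain q where q: "q \<in> \<Gamma>"
        "\<And>x y. x \<in> carrier L \<Longrightarrow> y \<in> carrier L \<Longrightarrow> p (bracket L x y) \<le> q x * q y"
        using bracket_boundedE[OF bracket_bounded_cont_seminorms[OF lcl] p] by metis
      show "\<exists>q\<in>st_seminorm E L ` \<Gamma>. \<forall>x\<in>fin_part E L T H. \<forall>y\<in>fin_part E L T H.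
          st_seminorm E L p (star_bracket E L x y) \<le> q x * q y"
        using q(1) st_seminorm_bracket_le[OF p q]
        by (intro bexI[of _ "st_seminorm E L q"]) auto
    qed
  qed
qed

sublocale A: seminormed_lie_algebra A "st_seminorm E L ` \<Gamma>"
  by (rule seminormed_lie_algebra_finite)


section \<open>The nonstandard hull\<close>

text \<open>
  Infinitesimal values are those with standard part zero; that infinitesimal elements are finite is
  part of the claim.
\<close>

lemma inf_part_eq_null_space: "I = null_space A (st_seminorm E L ` \<Gamma>)"
proof -
  have infinitesimal: "hinfinitesimal E (star_seminorm E L p z) \<longleftrightarrow> ((\<lambda>v. p (a v)) \<longlongrightarrow> 0) (germ E xs)"
    if "vrep E L xs z a" for p z xs a
    by (rule hinfinitesimal_iff[OF tp nrep_star_seminorm[OF tp that]])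
  show ?thesis
  proof (rule equalityI; rule subsetI)
    fix z assume z: "z \<in> I"
    then have "z \<in> H" by (simp add: inf_part_def)
    then obtain a where a: "vrep E L [z] z a" by (rule vrep_subalgebra[of z "[z]"]) simp
    have lim: "((\<lambda>v. p (a v)) \<longlongrightarrow> 0) (germ E [z])" if "p \<in> \<Gamma>" for p
      using z that infinitesimal[OF a] by (simp add: inf_part_def)
    have "z \<in> fin_part E L T H"
      using \<open>z \<in> H\<close> a
    proof (rule fin_partI)
      show "\<exists>g l. eventually (\<lambda>v. p (a v) \<le> g v) (germ E [z]) \<and> (g \<longlongrightarrow> l) (germ E [z])"
        if "p \<in> \<Gamma>" for p
        using lim[OF that] by (intro exI[of _ "\<lambda>v. p (a v)"]) auto
    qed
    moreover have "st_seminorm E L p z = 0" if "p \<in> \<Gamma>" for p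
      using a lim[OF that] by (rule st_seminorm_eq)
    ultimately show "z \<in> null_space A (st_seminorm E L ` \<Gamma>)"
      by (simp add: null_space_def finite_lie_simps)
  next
    fix z assume "z \<in> null_space A (st_seminorm E L ` \<Gamma>)"
    then have z: "z \<in> fin_part E L T H" "\<And>p. p \<in> \<Gamma> \<Longrightarrow> st_seminorm E L p z = 0"
      by (auto simp: null_space_def finite_lie_simps)
    then have "z \<in> H" by (simp add: fin_part_def)
    then obtain a where a: "vrep E L [z] z a" by (rule vrep_subalgebra[of z "[z]"]) simp
    have "hinfinitesimal E (star_seminorm E L p z)" if "p \<in> \<Gamma>" for p
      using tendsto_st_seminorm[OF z(1) a that] z(2)[OF that] infinitesimal[OF a] by simp
    then show "z \<in> I" using \<open>z \<in> H\<close> by (simp add: inf_part_def)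
  qed
qed

text \<open>
  With the infinitesimals identified as a null space, both sides are the same record of unions over
  representatives.
\<close>

lemma nonstd_hull_eq: "nonstd_hull E L T H = A.separated_quotient"
  unfolding inf_part_eq_null_space[symmetric]
  by (simp add: nonstd_hull_def lie_quotient_def lie_coset_def hull_class_def finite_lie_def
      cong: image_cong_simp)

lemma hull_topology_eq:
  "hull_topology E L T H =
     seminorm_topology A.separated_quotient (quotient_seminorm ` st_seminorm E L ` \<Gamma>)"
proof -
  have "hull_seminorm E L p = quotient_seminorm (st_seminorm E L p)" for p
    by (rule ext) (simp add: hull_seminorm_def quotient_seminorm_def st_seminorm_def)
  then show ?thesis by (simp add: hull_topology_def nonstd_hull_eq image_image)
qed

theorem locally_convex_lie_algebra_hull:
  "locally_convex_lie_algebra (nonstd_hull E L T H) (hull_topology E L T H)"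
proof -
  interpret Q: seminormed_lie_algebra A.separated_quotient "quotient_seminorm ` st_seminorm E L ` \<Gamma>"
    by (rule A.seminormed_lie_algebra_quotient)
  have "\<Gamma> \<noteq> {}"
    using lcl by (intro cont_seminorms_nonempty) (simp add: locally_convex_lie_algebra_def)
  then show ?thesis
    unfolding nonstd_hull_eq hull_topology_eq
    by (intro Q.locally_convex_lie_algebra_seminorm_topology) (auto intro!: A.quotient_separated)
qed

end

theorem lemma2p2:
  fixes \<gg> :: "'g lie" and T :: "'g topology"
    and E :: "('g, 's) lie_extension" and \<hh> :: "'s set"
  assumes "transfer_principle E"
    and "saturated E (UNIV :: nat set)" and "saturated E (cont_seminorms \<gg> T)"
    and "locally_convex_lie_algebra \<gg> T"
    and "internal_lie_subalgebra E \<gg> \<hh>"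
  shows "continuous_map
           (prod_topology (hull_topology E \<gg> T \<hh>) (hull_topology E \<gg> T \<hh>))
           (hull_topology E \<gg> T \<hh>)
           (\<lambda>(X, Y). bracket (nonstd_hull E \<gg> T \<hh>) X Y) \<and>
         locally_convex_lie_algebra (nonstd_hull E \<gg> T \<hh>) (hull_topology E \<gg> T \<hh>)"
proof -
  interpret internal_subalgebra \<gg> T E \<hh>
    using assms
    by (intro internal_subalgebra.intro internal_subalgebra_axioms.intro)
      (auto simp: locally_convex_lie_algebra_def)
  show ?thesis
    using locally_convex_lie_algebra_hull by (simp add: locally_convex_lie_algebra_def)
qed

end
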